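(* Assume the following. (1) (Local Lipschitz) For each $R>0$ there is $C_R>0$ such that $|f(x)-f(y)|+|g(x)-g(y)|\le C_R|x-y|$ for all $x,y\in\mathbb{R}^d$ with $|x|\vee|y|\le R$. (2) There exist constants $p\ge2$, $K_6>0$, $K_7\ge0$ such that $\langle x,f(x)\rangle+\frac{p-1}{2}|g(x)|^2\le -K_6|x|^2+K_7$ for all $x\in\mathbb{R}^d$. (3) There is a constant $\delta_{\max}\in(0,\infty)$ such that the timestep function $\delta:\mathbb{R}^d\to(0,\delta_{\max}]$ is continuous, $\lim_{|x|\to\infty}\delta(x)=0$, and there is a constant $\gamma\in(0,1/3]$ such that $|f(x)|(\delta(x))^\gamma\le 1+|x|$ and $|g(x)|^2(\delta(x))^\gamma\le(1+|x|)^2$ for all $x\in\mathbb{R}^d$. Then there is a constant $C>0$ such that $$\sup_{t\ge0}\mathbb{E}|Y(t)|^p\le C,\qquad \sup_{t\ge0}\mathbb{E}|\hat Y(t)|^p\le C.$$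
   Context: $(\Omega,\mathcal{F},\mathbb{P})$ is a complete probability space with a filtration $\{\mathcal{F}_t\}_{t\ge0}$ satisfying the usual conditions, and $W$ is an $m$-dimensional Brownian motion with respect to it. $f:\mathbb{R}^d\to\mathbb{R}^d$, $g:\mathbb{R}^d\to\mathbb{R}^{d\times m}$, $x_0\in\mathbb{R}^d$. $|\cdot|$ is the Euclidean norm on $\mathbb{R}^d$ and the Frobenius norm on $\mathbb{R}^{d\times m}$; $a\vee b=\max\{a,b\}$. Adaptive time-stepping Euler--Maruyama scheme with timestep function $\delta$: $t_0=0$, $Y_{t_0}=x_0$, and for $n\ge0$, $\delta_n=\delta(Y_{t_n})$, $t_{n+1}=t_n+\delta_n$, $Y_{t_{n+1}}=Y_{t_n}+f(Y_{t_n})\delta_n+g(Y_{t_n})(W(t_{n+1})-W(t_n))$. For $t\ge0$ (with $t<\sup_n t_n$) put $\underline{t}=\max\{t_n:t_n\le t\}$, $Y(t)=Y_{\underline t}$ and $\hat Y(t)=Y_{\underline t}+f(Y_{\underline t})(t-\underline t)+g(Y_{\underline t})(W(t)-W(\underline t))$. *)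

theory Defs
  imports "HOL-Probability.Probability"
begin

text \<open>
  A filtration indexed by the times \<open>t \<ge> 0\<close> is a function \<open>F\<close> on \<open>real\<close>; its values at negative
  times are irrelevant, hence \<open>max 0\<close> in the instance of the library's \<open>filtration\<close>.
\<close>

locale usual_conditions =
  prob_space M + complete_measure M + filtration "space M" "\<lambda>t. F (max 0 t)"
  for M :: "'a measure" and F :: "real \<Rightarrow> 'a measure" +
  assumes subalg: "0 \<le> t \<Longrightarrow> subalgebra M (F t)"
    and right_continuous: "0 \<le> t \<Longrightarrow> sets (F t) = (\<Inter>u\<in>{t<..}. sets (F u))"
    and null_sets_F0: "null_sets M \<subseteq> sets (F 0)"

text \<open>
  Brownian motion relative to \<open>F\<close>, of dimension \<open>CARD('m)\<close>: an increment over \<open>[s, t]\<close> is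
  independent of \<open>F s\<close> and has distribution \<open>N(0, (t - s) I)\<close>. The second parameter of
  \<open>normal_density\<close> is the standard deviation.
\<close>

locale brownian_motion = usual_conditions M F
  for M :: "'a measure" and F :: "real \<Rightarrow> 'a measure" +
  fixes W :: "real \<Rightarrow> 'a \<Rightarrow> real ^ 'm"
  assumes adapted: "0 \<le> t \<Longrightarrow> W t \<in> F t \<rightarrow>\<^sub>M borel"
    and start: "AE \<omega> in M. W 0 \<omega> = 0"
    and continuous_paths: "AE \<omega> in M. continuous_on {0..} (\<lambda>t. W t \<omega>)"
    and increments_indep_past: "0 \<le> s \<Longrightarrow> s < t \<Longrightarrow>
      indep_set (sets (F s)) (sets (vimage_algebra (space M) (\<lambda>\<omega>. W t \<omega> - W s \<omega>) borel))"
    and increments_normal: "0 \<le> s \<Longrightarrow> s < t \<Longrightarrow>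
      distributed M lborel (\<lambda>\<omega>. (W t \<omega> - W s \<omega>) $ i) (normal_density 0 (sqrt (t - s)))"
    and increments_indep_components: "0 \<le> s \<Longrightarrow> s < t \<Longrightarrow>
      indep_vars (\<lambda>_. borel) (\<lambda>i \<omega>. (W t \<omega> - W s \<omega>) $ i) UNIV"

text \<open>
  The scheme is defined pathwise, for a driving path \<open>w\<close>. \<open>em_grid f g \<delta> x0 w n\<close> is the pair
  \<open>(t\<^sub>n, Y\<^bsub>t\<^sub>n\<^esub>)\<close>. The coefficient \<open>g\<close> is matrix-valued; the library's \<open>norm\<close>
  on \<open>real ^ 'm ^ 'd\<close> is the Frobenius norm.
\<close>

primrec em_grid :: "(real ^ 'd \<Rightarrow> real ^ 'd) \<Rightarrow> (real ^ 'd \<Rightarrow> real ^ 'm ^ 'd) \<Rightarrow> (real ^ 'd \<Rightarrow> real)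
    \<Rightarrow> real ^ 'd \<Rightarrow> (real \<Rightarrow> real ^ 'm) \<Rightarrow> nat \<Rightarrow> real \<times> (real ^ 'd)" where
  "em_grid f g \<delta> x0 w 0 = (0, x0)"
| "em_grid f g \<delta> x0 w (Suc n) =
    (let (t, y) = em_grid f g \<delta> x0 w n; t' = t + \<delta> y
     in (t', y + \<delta> y *\<^sub>R f y + g y *v (w t' - w t)))"

definition em_time where
  "em_time f g \<delta> x0 w n = fst (em_grid f g \<delta> x0 w n)"

definition em_value where
  "em_value f g \<delta> x0 w n = snd (em_grid f g \<delta> x0 w n)"

text \<open>
  The following three functions are meaningful only for \<open>0 \<le> t < sup\<^sub>n t\<^sub>n\<close>. For larger \<open>t\<close>
  the set under \<open>Max\<close> is infinite and the values are arbitrary.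
\<close>

definition em_floor where
  "em_floor f g \<delta> x0 w t = Max {s \<in> range (em_time f g \<delta> x0 w). s \<le> t}"

definition em_step where
  "em_step f g \<delta> x0 w t =
    em_value f g \<delta> x0 w (THE n. em_time f g \<delta> x0 w n = em_floor f g \<delta> x0 w t)"

definition em_interp where
  "em_interp f g \<delta> x0 w t =
    (let s = em_floor f g \<delta> x0 w t; y = em_step f g \<delta> x0 w t
     in y + (t - s) *\<^sub>R f y + g y *v (w t - w s))"

end

theory Submission
  imports Defs
begin

text \<open>
  The proof is a Lyapunov argument for \<open>V x = (1 + |x|\<^sup>2) powr (p/2)\<close>, carried out without stochastic
  calculus: everything about the noise is used through single Gaussian steps.

  \<^bold>\<open>One step.\<close> For a state \<open>y\<close>, a time \<open>s \<le> \<delta> y\<close> and a standard Gaussian \<open>Z\<close>, put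
  \<open>Y' = y + s f(y) + sqrt s g(y) Z\<close>. The claim is
  \<open>E V(Y') \<le> exp(-\<lambda> s) V(y) + C (1 - exp(-\<lambda> s))\<close> with \<open>\<lambda> = p K6 / 2\<close> (lemma
  \<open>one_step_contraction\<close>). A Taylor expansion with third-order remainder would leave an error of
  order \<open>s powr (3 (1 - \<gamma>) / 2)\<close>, which for \<open>\<gamma> = 1/3\<close> is no better than \<open>s\<close>. Since \<open>Z\<close> and \<open>-Z\<close> have the same
  law, \<open>V(a + b)\<close> may be replaced by the mean of \<open>V(a + b)\<close> and \<open>V(a - b)\<close>, and the odd terms cancel;
  the error is then of order \<open>s powr (2 - 2 \<gamma>) \<le> s powr (4/3)\<close> for \<open>s \<le> 1\<close>. The second-order term is bounded in the
  worst case, where the noise is parallel to the drifted state, and this produces exactly the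
  factor \<open>(p - 1)/2\<close> of the coercivity condition. Far from the origin \<open>\<delta>\<close> is small, so the error is
  absorbed by the dissipation; on a ball all coefficients are bounded and the growth over a time \<open>s\<close>
  is at most linear in \<open>s\<close>.

  \<^bold>\<open>Random times.\<close> The grid times are stopping times and each step length is known at the start of the
  step, but independence of increments is only given at deterministic times. Rounding the
  start of the step up and its length down to a grid of mesh \<open>1/k\<close> reduces to countably many
  deterministic cases. As the one-step bound holds for every \<open>s \<le> \<delta> y\<close>, it survives the rounding with
  the same constant, and Fatou's lemma along the continuous paths gives it for the true step
  (lemma \<open>random_time_step_le\<close>).

  \<^bold>\<open>Summing up.\<close> Fix a horizon \<open>T\<close>. The one-step bound says that
  \<open>exp(\<lambda> t) V(y) + C (exp(\<lambda> T) - exp(\<lambda> t))\<close> decreases in expectation along every walk that makes steps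
  of length at most \<open>\<delta> y\<close> and never passes \<open>T\<close> (lemma \<open>U_supermartingale\<close>). Two such walks matter,
  and both almost surely become constant. One shortens its last step so as to stop exactly at \<open>T\<close>; its final state is the continuous
  interpolation at \<open>T\<close>. The other stays at the last grid point before \<open>T\<close>; its final state is
  the step process at \<open>T\<close>. Fatou's lemma along the walk bounds both moments by
  \<open>exp(\<lambda> \<delta>max) (V x0 + C)\<close>, uniformly in \<open>T\<close>. The same bound excludes explosion: if all grid times
  stayed below \<open>T\<close>, then the step lengths would tend to \<open>0\<close>, hence the grid values to infinity,
  and the limit inferior of the Lyapunov values would be infinite.
\<close>

section \<open>Symmetrised powers\<close>

lemma powr_le_two_powr_abs:
  fixes x a :: real
  assumes "1/2 \<le> x" "x \<le> 2"
  shows "x powr a \<le> 2 powr \<bar>a\<bar>"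
proof -
  have "x powr a = exp (a * ln x)" using assms by (simp add: powr_def)
  also have "a * ln x \<le> \<bar>a\<bar> * \<bar>ln x\<bar>" by (metis abs_ge_self abs_mult)
  also have "\<bar>ln x\<bar> \<le> ln 2"
  proof -
    have "ln x \<le> ln 2" using assms by simp
    moreover have "ln (1/2) \<le> ln x" using assms by (subst ln_le_cancel_iff) auto
    moreover have "ln (1/2::real) = - ln 2" by (simp add: ln_div)
    ultimately show ?thesis by linarith
  qed
  finally show ?thesis by (simp add: powr_def mult_left_mono)
qed

text \<open>
  Averaging over both signs removes the terms of odd order, so the remainder is of order \<open>r\<^sup>4\<close>.
  For \<open>r \<le> 1/2\<close> this is Taylor's formula, with \<open>c m\<close> the falling factorials of \<open>p\<close>. For larger \<open>r\<close> the
  whole left-hand side is at most \<open>(1 + r) powr p \<le> 16 r\<^sup>4 (1 + r) powr p\<close>; the factor \<open>(1 + r) powr p\<close> is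
  there to make this possible.
\<close>
lemma symmetrised_powr_le:
  fixes p :: real
  assumes "2 \<le> p"
  obtains C where "0 \<le> C"
    "\<And>r. 0 \<le> r \<Longrightarrow> ((1 + r) powr p + \<bar>1 - r\<bar> powr p) / 2
       \<le> 1 + p * (p - 1) / 2 * r\<^sup>2 + C * r ^ 4 * (1 + r) powr p"
proof -
  define c where "c m = (\<Prod>i<m. p - real i)" for m :: nat
  define D where "D m t = c m * (((1 + t) powr (p - real m)
      + (-1) ^ m * (1 - t) powr (p - real m)) / 2)" for m :: nat and t :: real
  define C where "C = \<bar>c 4\<bar> * 2 powr \<bar>p - 4\<bar> + 16"
  have C0: "0 \<le> C" by (simp add: C_def)
  have "((1 + r) powr p + \<bar>1 - r\<bar> powr p) / 2
       \<le> 1 + p * (p - 1) / 2 * r\<^sup>2 + C * r ^ 4 * (1 + r) powr p" if r: "0 \<le> r" for r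
  proof -
    consider "r = 0" | "0 < r" "r \<le> 1/2" | "1/2 < r" using r by linarith
    then show ?thesis
    proof cases
      case 1 then show ?thesis by simp
    next
      case 2
      have "\<exists>t. 0 < t \<and> t \<le> r \<and> D 0 r = (\<Sum>m<4. D m 0 / fact m * r ^ m) + D 4 t / fact 4 * r ^ 4"
      proof (rule Maclaurin2[OF \<open>0 < r\<close> refl], intro allI impI)
        fix m :: nat and t :: real assume t: "m < 4 \<and> 0 \<le> t \<and> t \<le> r"
        then have pos: "0 < 1 + t" "0 < 1 - t" using 2 by auto
        have cS: "c (Suc m) = c m * (p - real m)" by (simp add: c_def)
        show "(D m has_field_derivative D (Suc m) t) (at t)"
          unfolding D_def[abs_def] cS using pos
          by (auto intro!: derivative_eq_intros simp: field_simps)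
      qed
      then obtain t where t: "0 < t" "t \<le> r"
        and eq: "D 0 r = (\<Sum>m<4. D m 0 / fact m * r ^ m) + D 4 t / fact 4 * r ^ 4" by blast
      have s: "(\<Sum>m<4. D m 0 / fact m * r ^ m) = 1 + p * (p - 1) / 2 * r\<^sup>2"
        by (simp add: eval_nat_numeral D_def c_def)
      have "(1 + t) powr (p - 4) \<le> 2 powr \<bar>p - 4\<bar>" "(1 - t) powr (p - 4) \<le> 2 powr \<bar>p - 4\<bar>"
        using t 2 by (auto intro!: powr_le_two_powr_abs)
      then have "D 4 t \<le> \<bar>c 4\<bar> * 2 powr \<bar>p - 4\<bar>"
        unfolding D_def by (intro mult_mono) auto
      moreover have "0 \<le> \<bar>c 4\<bar> * 2 powr \<bar>p - 4\<bar>" by simp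
      moreover have f4: "fact 4 = (24::real)" by (simp add: fact_numeral)
      ultimately have D4: "D 4 t / fact 4 \<le> C"
        unfolding C_def f4 by linarith
      have "1 \<le> (1 + r) powr p" using r assms by (simp add: ge_one_powr_ge_zero)
      then have "C \<le> C * (1 + r) powr p" using C0 by (simp add: mult_le_cancel_left1)
      then have "D 4 t / fact 4 * r ^ 4 \<le> C * (1 + r) powr p * r ^ 4"
        using D4 by (intro mult_right_mono) auto
      moreover have "D 0 r = ((1 + r) powr p + \<bar>1 - r\<bar> powr p) / 2"
        using 2 by (simp add: D_def c_def)
      ultimately show ?thesis using eq s by (simp add: mult_ac)
    next
      case 3
      have "\<bar>1 - r\<bar> powr p \<le> (1 + r) powr p" using r assms by (intro powr_mono2) auto
      then have "((1 + r) powr p + \<bar>1 - r\<bar> powr p) / 2 \<le> (1 + r) powr p" by simp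
      also have "1 \<le> C * r ^ 4"
      proof -
        have "(1/2) ^ 4 \<le> r ^ 4" using 3 by (intro power_mono) auto
        moreover have "16 * r ^ 4 \<le> C * r ^ 4" by (intro mult_right_mono) (auto simp: C_def)
        ultimately show ?thesis by (simp add: power_numeral_reduce)
      qed
      then have "(1 + r) powr p \<le> C * r ^ 4 * (1 + r) powr p"
        using mult_right_mono[of 1 "C * r ^ 4" "(1 + r) powr p"] by simp
      moreover have "0 \<le> p * (p - 1) / 2 * r\<^sup>2" using assms by simp
      ultimately show ?thesis by linarith
    qed
  qed
  with C0 show thesis by (rule that)
qed

text \<open>
  The open half-line is a library fact; the endpoint \<open>0\<close> is needed below, because \<open>a\<^sup>2 + b\<^sup>2 - 2 c\<close> can
  vanish.
\<close>
lemma convex_on_powr_nonneg: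
  fixes q :: real
  assumes "1 \<le> q"
  shows "convex_on {0..} (\<lambda>x. x powr q)"
proof (rule convex_onI)
  fix t x y :: real
  assume t: "0 < t" "t < 1" and xy: "x \<in> {0..}" "y \<in> {0..}"
  have le: "u powr q \<le> u" if "0 < u" "u < 1" for u :: real
    using powr_mono'[OF assms, of u] that by simp
  consider "x = 0" | "y = 0" | "0 < x" "0 < y" using xy by force
  then show "((1 - t) *\<^sub>R x + t *\<^sub>R y) powr q \<le> (1 - t) * x powr q + t * y powr q"
  proof cases
    case 1 then show ?thesis using t xy le[of t] by (simp add: powr_mult mult_right_mono)
  next
    case 2 then show ?thesis using t xy le[of "1 - t"] by (simp add: powr_mult mult_right_mono)
  next
    case 3 then show ?thesis
      using powr_convex[OF assms] t unfolding convex_on_def by simp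
  qed
qed simp

text \<open>
  With \<open>a\<^sup>2 + b\<^sup>2\<close> fixed, the left-hand side is an even convex function of \<open>c\<close>, hence maximal at the
  endpoints \<open>c = a b\<close> and \<open>c = -a b\<close>. In the application \<open>c\<close> is an inner product of two vectors, and the
  endpoints are the case of parallel vectors, so the vector problem becomes one-dimensional.
\<close>
lemma powr_spread_le:
  fixes a b c q :: real
  assumes "1 \<le> q" "0 \<le> a" "0 \<le> b" "\<bar>c\<bar> \<le> a * b"
  shows "(a\<^sup>2 + b\<^sup>2 + 2 * c) powr q + (a\<^sup>2 + b\<^sup>2 - 2 * c) powr q
    \<le> (a + b) powr (2 * q) + \<bar>a - b\<bar> powr (2 * q)"
proof (cases "a * b = 0")
  case True
  then have "c = 0" using assms(4) by (metis abs_le_zero_iff)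
  then show ?thesis using True assms
    by (auto simp: powr_powr[symmetric] powr_realpow' simp flip: powr_numeral)
next
  case False
  then have ab: "0 < a * b" using assms by simp
  \<comment> \<open>Both bases are convex combinations, with weights \<open>th\<close> and \<open>1 - th\<close>, of \<open>(a + b)\<^sup>2\<close> and \<open>(a - b)\<^sup>2\<close>.\<close>
  define x where "x = c / (a * b)"
  define th where "th = (1 + x) / 2"
  have "\<bar>c / (a * b)\<bar> = \<bar>c\<bar> / (a * b)" using ab by (simp only: abs_divide abs_of_pos)
  also have "\<dots> \<le> 1" using assms(4) ab by (simp add: divide_le_eq)
  finally have "\<bar>x\<bar> \<le> 1" by (simp only: x_def)
  then have th: "0 \<le> th" "th \<le> 1" by (auto simp: th_def abs_le_iff)
  define u where "u = (a + b)\<^sup>2"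
  define v where "v = (a - b)\<^sup>2"
  have ce: "c = (2 * th - 1) * (a * b)" using False by (simp add: th_def x_def field_simps)
  have e1: "a\<^sup>2 + b\<^sup>2 + 2 * c = (1 - th) * v + th * u"
    unfolding ce by (simp add: u_def v_def power2_eq_square algebra_simps)
  have e2: "a\<^sup>2 + b\<^sup>2 - 2 * c = th * v + (1 - th) * u"
    unfolding ce by (simp add: u_def v_def power2_eq_square algebra_simps)
  have cv: "convex_on {0..} (\<lambda>x. x powr q)" by (rule convex_on_powr_nonneg[OF assms(1)])
  have "(a\<^sup>2 + b\<^sup>2 + 2 * c) powr q \<le> (1 - th) * v powr q + th * u powr q"
    using convex_onD[OF cv th(1) th(2), of v u] by (simp add: e1 u_def v_def)
  moreover have "(a\<^sup>2 + b\<^sup>2 - 2 * c) powr q \<le> th * v powr q + (1 - th) * u powr q"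
    using convex_onD[OF cv, of "1 - th" v u] th by (simp add: e2 u_def v_def)
  ultimately have "(a\<^sup>2 + b\<^sup>2 + 2 * c) powr q + (a\<^sup>2 + b\<^sup>2 - 2 * c) powr q \<le> u powr q + v powr q"
    by (simp add: algebra_simps)
  moreover have "u powr q = (a + b) powr (2 * q)"
    using assms ab by (simp add: u_def powr_powr flip: powr_numeral)
  moreover have "v powr q = \<bar>a - b\<bar> powr (2 * q)"
  proof -
    have "v = \<bar>a - b\<bar> powr 2" by (cases "a = b") (auto simp: v_def)
    then show ?thesis by (simp only: powr_powr)
  qed
  ultimately show ?thesis by simp
qed

section \<open>Moments of a noisy step\<close>

text \<open>
  These are the only features of the Gaussian law that the one-step estimate uses: invariance under
  reflection, identity covariance and finite moments.
\<close>
locale isotropic_noise = prob_space \<mu> for \<mu> :: "(real ^ 'm) measure" +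
  assumes sets_eq [measurable_cong, simp]: "sets \<mu> = sets borel"
    and symmetric: "distr \<mu> borel uminus = \<mu>"
    and isotropic: "(\<integral>z. z $ i * z $ j \<partial>\<mu>) = (if i = j then 1 else 0)"
    and moments: "integrable \<mu> (\<lambda>z. norm z ^ n)"

lemma borel_measurable_matrix_vector_mult [measurable]:
  fixes G :: "real ^ 'm ^ 'd"
  shows "(*v) G \<in> borel_measurable borel"
  by (intro borel_measurable_continuous_onI matrix_vector_mult_linear_continuous_on)

lemma norm_matrix_vector_mult_le:
  fixes G :: "real ^ 'm ^ 'd"
  shows "norm (G *v z) \<le> norm G * norm z"
proof -
  have "(norm (G *v z))\<^sup>2 = (\<Sum>k\<in>UNIV. ((G $ k) \<bullet> z)\<^sup>2)"
    by (simp add: norm_vec_def L2_set_def sum_nonneg matrix_vector_mul_component)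
  also have "\<dots> \<le> (\<Sum>k\<in>UNIV. (norm (G $ k))\<^sup>2 * (norm z)\<^sup>2)"
    by (intro sum_mono) (metis Cauchy_Schwarz_ineq power2_norm_eq_inner)
  also have "\<dots> = (norm G * norm z)\<^sup>2"
    by (simp add: norm_vec_def[of G] L2_set_def sum_nonneg power_mult_distrib sum_distrib_right)
  finally show ?thesis by (rule power2_le_imp_le) simp
qed

text \<open>
  Reduces moments of \<open>1 + \<kappa> |z|\<close> to moments of \<open>|z|\<close>.
\<close>
lemma one_plus_power_le:
  fixes u :: real
  assumes "0 \<le> u"
  shows "(1 + u) ^ n \<le> 2 ^ n * (1 + u ^ n)"
proof -
  have "(1 + u) ^ n \<le> (2 * max 1 u) ^ n" using assms by (intro power_mono) auto
  also have "\<dots> = 2 ^ n * max 1 u ^ n" by (simp add: power_mult_distrib)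
  also have "max 1 u ^ n \<le> 1 + u ^ n" using assms by (auto simp: max_def)
  finally show ?thesis by simp
qed

context isotropic_noise
begin

lemma space_noise [simp]: "space \<mu> = UNIV"
  using sets_eq_imp_space_eq[OF sets_eq] by simp

lemma integrable_component_product: "integrable \<mu> (\<lambda>z. z $ i * z $ j)"
proof (rule Bochner_Integration.integrable_bound[OF moments[of 2]])
  show "AE z in \<mu>. norm (z $ i * z $ j) \<le> norm (norm z ^ 2)"
    by (intro AE_I2) (auto simp: abs_mult power2_eq_square intro!: mult_mono component_le_norm_cart)
qed simp

lemma second_moment:
  fixes G :: "real ^ 'm ^ 'd"
  shows "integrable \<mu> (\<lambda>z. (norm (G *v z))\<^sup>2)" "(\<integral>z. (norm (G *v z))\<^sup>2 \<partial>\<mu>) = (norm G)\<^sup>2"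
proof -
  have eq: "(norm (G *v z))\<^sup>2 = (\<Sum>k\<in>UNIV. \<Sum>i\<in>UNIV. \<Sum>j\<in>UNIV. (G $ k $ i * G $ k $ j) * (z $ i * z $ j))" for z
  proof -
    have "(norm (G *v z))\<^sup>2 = (\<Sum>k\<in>UNIV. ((G *v z) $ k)\<^sup>2)"
      by (simp add: norm_vec_def L2_set_def sum_nonneg)
    then show ?thesis
      by (simp add: matrix_vector_mult_def power2_eq_square sum_product mult_ac)
  qed
  show "integrable \<mu> (\<lambda>z. (norm (G *v z))\<^sup>2)"
    unfolding eq by (intro Bochner_Integration.integrable_sum integrable_mult_right integrable_component_product)
  have "(\<integral>z. (norm (G *v z))\<^sup>2 \<partial>\<mu>) = (\<Sum>k\<in>UNIV. \<Sum>i\<in>UNIV. \<Sum>j\<in>UNIV. (G $ k $ i * G $ k $ j) * (if i = j then 1 else 0))"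
    unfolding eq
    by (subst Bochner_Integration.integral_sum,
        intro Bochner_Integration.integrable_sum integrable_mult_right integrable_component_product)+
       (simp add: isotropic integrable_component_product)
  also have "\<dots> = (norm G)\<^sup>2"
    by (simp add: norm_vec_def L2_set_def sum_nonneg power2_eq_square if_distrib cong: if_cong)
  finally show "(\<integral>z. (norm (G *v z))\<^sup>2 \<partial>\<mu>) = (norm G)\<^sup>2" .
qed

text \<open>
  Write \<open>1 + |x|\<^sup>2\<close> as the squared norm of \<open>(1, x)\<close>, and let \<open>al \<ge> 1\<close> be the norm of \<open>(1, a)\<close>. Averaging
  over \<open>z\<close> and \<open>-z\<close>, \<open>powr_spread_le\<close> and \<open>symmetrised_powr_le\<close> bound the integrand by \<open>al powr p\<close> times the
  expansion in \<open>r = |G z| / al\<close>; since \<open>E |G z|\<^sup>2 = |G|\<^sup>2\<close>, integration gives the claim. The bound \<open>M0\<close> on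
  \<open>|G|\<^sup>2 / al\<^sup>2\<close> makes the factor \<open>(1 + r) powr p\<close> of the remainder integrable with a constant that does not
  depend on \<open>a\<close> and \<open>G\<close>.
\<close>
lemma symmetric_noise_moment_le:
  fixes p M0 :: real
  assumes p: "2 \<le> p" and M0: "0 \<le> M0"
  obtains C where "0 \<le> C"
    "\<And>(a :: real ^ 'd) (G :: real ^ 'm ^ 'd). (norm G)\<^sup>2 \<le> M0 * (1 + (norm a)\<^sup>2) \<Longrightarrow>
      (\<integral>\<^sup>+z. ennreal ((1 + (norm (a + G *v z))\<^sup>2) powr (p / 2)) \<partial>\<mu>)
      \<le> ennreal ((1 + (norm a)\<^sup>2) powr (p / 2) *
          (1 + p * (p - 1) / 2 * ((norm G)\<^sup>2 / (1 + (norm a)\<^sup>2))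
            + C * ((norm G)\<^sup>2 / (1 + (norm a)\<^sup>2))\<^sup>2))"
proof -
  obtain C0 where C0: "0 \<le> C0"
    "\<And>r. 0 \<le> r \<Longrightarrow> ((1 + r) powr p + \<bar>1 - r\<bar> powr p) / 2
       \<le> 1 + p * (p - 1) / 2 * r\<^sup>2 + C0 * r ^ 4 * (1 + r) powr p"
    using symmetrised_powr_le[OF p] by blast
  define N where "N = nat \<lceil>p\<rceil>"
  have N: "p \<le> real N" unfolding N_def by linarith
  define Q where "Q z = 2 ^ N * (norm z ^ 4 + sqrt M0 ^ N * norm z ^ (N + 4))" for z :: "real ^ 'm"
  have Qint: "integrable \<mu> Q"
    unfolding Q_def by (intro integrable_mult_right Bochner_Integration.integrable_add moments)
  have Q0: "0 \<le> Q z" for z unfolding Q_def using M0 by simp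
  define C where "C = C0 * (\<integral>z. Q z \<partial>\<mu>)"
  show thesis
  proof (rule that)
    show "0 \<le> C" unfolding C_def using C0 Q0 by (simp add: integral_nonneg_AE)
    fix a :: "real ^ 'd" and G :: "real ^ 'm ^ 'd"
    assume G: "(norm G)\<^sup>2 \<le> M0 * (1 + (norm a)\<^sup>2)"
    define al where "al = sqrt (1 + (norm a)\<^sup>2)"
    have al: "0 < al" "al\<^sup>2 = 1 + (norm a)\<^sup>2" by (auto simp: al_def add_nonneg_nonneg add_pos_nonneg)
    define eta where "eta = (norm G)\<^sup>2 / al\<^sup>2"
    have eta: "0 \<le> eta" "eta \<le> M0"
      using G al(1) unfolding al(2)[symmetric] eta_def by (simp_all add: divide_le_eq)
    define V where "V x = (1 + (norm x)\<^sup>2) powr (p / 2)" for x :: "real ^ 'd"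
    have V0: "0 \<le> V x" for x by (simp add: V_def)
    have Vm [measurable]: "V \<in> borel_measurable borel" unfolding V_def[abs_def] by measurable
    define R where "R z = al powr p * (1 + p * (p - 1) / 2 * ((norm (G *v z))\<^sup>2 / al\<^sup>2) + C0 * eta\<^sup>2 * Q z)" for z
    have pw: "V (a + G *v z) + V (a - G *v z) \<le> 2 * R z" for z
    proof -
      define b where "b = G *v z"
      define r where "r = norm b / al"
      have r0: "0 \<le> r" using al by (simp add: r_def)
      have "a \<bullet> b \<le> al * norm b" "- (a \<bullet> b) \<le> al * norm b"
      proof -
        have "norm a \<le> al" by (simp add: al_def real_le_rsqrt)
        then have "norm a * norm b \<le> al * norm b" by (intro mult_right_mono) auto
        moreover have "\<bar>a \<bullet> b\<bar> \<le> norm a * norm b" by (rule Cauchy_Schwarz_ineq2)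
        ultimately show "a \<bullet> b \<le> al * norm b" "- (a \<bullet> b) \<le> al * norm b" by auto
      qed
      then have ab: "\<bar>a \<bullet> b\<bar> \<le> al * norm b" by simp
      have e1: "1 + (norm (a + b))\<^sup>2 = al\<^sup>2 + (norm b)\<^sup>2 + 2 * (a \<bullet> b)"
        by (simp add: al power2_norm_eq_inner inner_simps inner_commute)
      have e2: "1 + (norm (a - b))\<^sup>2 = al\<^sup>2 + (norm b)\<^sup>2 - 2 * (a \<bullet> b)"
        by (simp add: al power2_norm_eq_inner inner_simps inner_commute)
      have "V (a + b) + V (a - b) \<le> (al + norm b) powr p + \<bar>al - norm b\<bar> powr p"
        unfolding V_def e1 e2 using powr_spread_le[of "p / 2" al "norm b" "a \<bullet> b"] p al(1) ab by simp
      also have "al + norm b = al * (1 + r)" using al by (simp add: r_def field_simps)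
      also have "\<bar>al - norm b\<bar> = al * \<bar>1 - r\<bar>"
      proof -
        have "al - norm b = al * (1 - r)" using al by (simp add: r_def field_simps)
        then show ?thesis using al by (simp add: abs_mult)
      qed
      also have "(al * (1 + r)) powr p + (al * \<bar>1 - r\<bar>) powr p
          = al powr p * ((1 + r) powr p + \<bar>1 - r\<bar> powr p)"
        using al(1) r0 by (subst (1 2) powr_mult) (auto simp: distrib_left)
      also have "\<dots> \<le> al powr p * (2 * (1 + p * (p - 1) / 2 * r\<^sup>2 + C0 * r ^ 4 * (1 + r) powr p))"
        using C0(2)[OF r0] by (intro mult_left_mono) auto
      also have "\<dots> \<le> al powr p * (2 * (1 + p * (p - 1) / 2 * ((norm b)\<^sup>2 / al\<^sup>2) + C0 * eta\<^sup>2 * Q z))"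
      proof -
        have rz: "r \<le> sqrt eta * norm z"
        proof -
          have "r \<le> norm G * norm z / al"
            unfolding r_def b_def using al by (intro divide_right_mono norm_matrix_vector_mult_le) auto
          then show ?thesis using al(1) by (simp add: eta_def real_sqrt_divide)
        qed
        have "r ^ 4 \<le> (sqrt eta * norm z) ^ 4" using rz r0 by (intro power_mono) auto
        also have "\<dots> = eta\<^sup>2 * norm z ^ 4"
        proof -
          have "sqrt eta ^ 4 = (sqrt eta ^ 2) ^ 2" by (simp add: power_mult[symmetric])
          then show ?thesis using eta by (simp add: power_mult_distrib)
        qed
        finally have r4: "r ^ 4 \<le> eta\<^sup>2 * norm z ^ 4" .
        have "(1 + r) powr p \<le> (1 + r) powr real N" using r0 N by (intro powr_mono) auto
        also have "\<dots> = (1 + r) ^ N" using r0 by (simp add: powr_realpow)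
        also have "\<dots> \<le> (1 + sqrt M0 * norm z) ^ N"
        proof (intro power_mono add_left_mono)
          have "sqrt eta * norm z \<le> sqrt M0 * norm z" using eta by (intro mult_right_mono) auto
          with rz show "r \<le> sqrt M0 * norm z" by simp
        qed (use r0 in auto)
        also have "\<dots> \<le> 2 ^ N * (1 + (sqrt M0 * norm z) ^ N)"
          using M0 by (intro one_plus_power_le) auto
        finally have rp: "(1 + r) powr p \<le> 2 ^ N * (1 + (sqrt M0 * norm z) ^ N)" .
        have "r ^ 4 * (1 + r) powr p \<le> (eta\<^sup>2 * norm z ^ 4) * (2 ^ N * (1 + (sqrt M0 * norm z) ^ N))"
          using r4 rp by (intro mult_mono) auto
        also have "\<dots> = eta\<^sup>2 * Q z"
          by (simp add: Q_def power_mult_distrib power_add algebra_simps)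
        finally have "C0 * (r ^ 4 * (1 + r) powr p) \<le> C0 * (eta\<^sup>2 * Q z)"
          using C0 by (intro mult_left_mono)
        moreover have "r\<^sup>2 = (norm b)\<^sup>2 / al\<^sup>2" by (simp add: r_def power_divide)
        ultimately show ?thesis by (intro mult_left_mono) (auto simp: mult.assoc)
      qed
      finally show ?thesis unfolding b_def R_def by (simp only: mult.left_commute[of 2])
    qed
    have Rint: "integrable \<mu> R"
      unfolding R_def by (intro integrable_mult_right Bochner_Integration.integrable_add integrable_divide second_moment Qint) simp
    have R0: "0 \<le> R z" for z
      unfolding R_def using p C0 Q0 by (intro mult_nonneg_nonneg add_nonneg_nonneg) auto
    have sym: "(\<integral>\<^sup>+z. ennreal (V (a - G *v z)) \<partial>\<mu>) = (\<integral>\<^sup>+z. ennreal (V (a + G *v z)) \<partial>\<mu>)"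
    proof -
      have "(\<integral>\<^sup>+z. ennreal (V (a + G *v z)) \<partial>\<mu>) = (\<integral>\<^sup>+z. ennreal (V (a + G *v z)) \<partial>(distr \<mu> borel uminus))"
        by (simp add: symmetric)
      also have "\<dots> = (\<integral>\<^sup>+z. ennreal (V (a + G *v (- z))) \<partial>\<mu>)"
        by (subst nn_integral_distr) auto
      also have "\<dots> = (\<integral>\<^sup>+z. ennreal (V (a - G *v z)) \<partial>\<mu>)"
        using matrix_vector_mult_diff_distrib[of G 0] by simp
      finally show ?thesis by simp
    qed
    have "2 * (\<integral>\<^sup>+z. ennreal (V (a + G *v z)) \<partial>\<mu>) = (\<integral>\<^sup>+z. ennreal (V (a + G *v z)) + ennreal (V (a - G *v z)) \<partial>\<mu>)"
      by (subst nn_integral_add) (auto simp: sym mult_2)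
    also have "\<dots> \<le> (\<integral>\<^sup>+z. 2 * ennreal (R z) \<partial>\<mu>)"
    proof (rule nn_integral_mono)
      fix z
      have "ennreal (V (a + G *v z)) + ennreal (V (a - G *v z)) = ennreal (V (a + G *v z) + V (a - G *v z))"
        using V0 by simp
      also have "\<dots> \<le> ennreal (2 * R z)" by (intro ennreal_leI pw)
      also have "\<dots> = 2 * ennreal (R z)" using R0 by (simp add: ennreal_mult)
      finally show "ennreal (V (a + G *v z)) + ennreal (V (a - G *v z)) \<le> 2 * ennreal (R z)" .
    qed
    also have "\<dots> = 2 * ennreal (\<integral>z. R z \<partial>\<mu>)"
      using Rint R0 by (subst nn_integral_cmult) (auto simp: nn_integral_eq_integral)
    finally have "(\<integral>\<^sup>+z. ennreal (V (a + G *v z)) \<partial>\<mu>) \<le> ennreal (\<integral>z. R z \<partial>\<mu>)"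
      by (subst (asm) ennreal_mult_le_mult_iff) auto
    also have "(\<integral>z. R z \<partial>\<mu>) = al powr p * (1 + p * (p - 1) / 2 * eta + C0 * eta\<^sup>2 * (\<integral>z. Q z \<partial>\<mu>))"
    proof -
      have h1: "has_bochner_integral \<mu> (\<lambda>z. 1) (1 :: real)"
        using prob_space by (simp add: has_bochner_integral_iff)
      have h2: "has_bochner_integral \<mu> (\<lambda>z. (norm (G *v z))\<^sup>2) ((norm G)\<^sup>2)"
        by (simp add: has_bochner_integral_iff second_moment)
      have h3: "has_bochner_integral \<mu> Q (\<integral>z. Q z \<partial>\<mu>)"
        using Qint by (simp add: has_bochner_integral_iff)
      have "has_bochner_integral \<mu> R (al powr p * (1 + p * (p - 1) / 2 * ((norm G)\<^sup>2 / al\<^sup>2)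
          + C0 * eta\<^sup>2 * (\<integral>z. Q z \<partial>\<mu>)))"
        unfolding R_def by (intro has_bochner_integral_mult_right has_bochner_integral_add
            has_bochner_integral_divide h1 h2 h3)
      then show ?thesis unfolding eta_def by (rule has_bochner_integral_integral_eq)
    qed
    also have "al powr p = (1 + (norm a)\<^sup>2) powr (p / 2)"
      unfolding al_def by (subst powr_half_sqrt[symmetric]) (auto simp: powr_powr add_nonneg_nonneg)
    finally show "(\<integral>\<^sup>+z. ennreal ((1 + (norm (a + G *v z))\<^sup>2) powr (p / 2)) \<partial>\<mu>)
      \<le> ennreal ((1 + (norm a)\<^sup>2) powr (p / 2) *
          (1 + p * (p - 1) / 2 * ((norm G)\<^sup>2 / (1 + (norm a)\<^sup>2))
            + C * ((norm G)\<^sup>2 / (1 + (norm a)\<^sup>2))\<^sup>2))"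
      by (simp add: V_def eta_def al C_def mult_ac)
  qed
qed

end

section \<open>One step of the scheme contracts\<close>

text \<open>
  This is the far-field estimate in scalar form, with \<open>Y = |y|\<close>, \<open>F = |f y|\<close>, \<open>G = |g y|\<close>, \<open>ip = y \<bullet> f y\<close> and
  \<open>A = 1 + |y + s f y|\<^sup>2\<close>; the number \<open>e\<close> will be \<open>s powr (1 - \<gamma>)\<close>. Put \<open>v = 1 + Y\<^sup>2\<close>, \<open>A = v (1 + w)\<close> and
  \<open>z = s G\<^sup>2 / v\<close>. The step-size conditions give \<open>|w| \<le> 6 e\<close> and \<open>z \<le> 2 e\<close>, so replacing \<open>A\<close> by \<open>v\<close> in
  \<open>s G\<^sup>2 / A\<close> costs at most \<open>24 e\<^sup>2\<close>. Bounding each factor by an exponential, the first-order part of the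
  exponent is \<open>p s / v\<close> times the left-hand side of the coercivity condition, hence at most
  \<open>-(3/4) p K6 s\<close> for large \<open>Y\<close>, and the remaining \<open>e\<^sup>2\<close> terms use up another quarter.
\<close>
lemma exponential_decay_estimate:
  fixes p K6 K7 C Y F G ip s e :: real
  assumes p: "2 \<le> p" and C: "0 \<le> C" and K6: "0 < K6" and Y: "0 \<le> Y" and s: "0 \<le> s"
    and ip: "\<bar>ip\<bar> \<le> Y * F"
    and coer: "ip + (p - 1) / 2 * G\<^sup>2 \<le> - K6 * Y\<^sup>2 + K7"
    and F: "0 \<le> F" "s * F \<le> e * (1 + Y)" and G: "s * G\<^sup>2 \<le> e * (1 + Y)\<^sup>2"
    and e: "0 \<le> e" "e \<le> 1/12" "(p + 12 * p * (p - 1) + 16 * C) * e\<^sup>2 \<le> p * K6 / 4 * s"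
    and Y_large: "p * (K6 + K7) / (1 + Y\<^sup>2) \<le> p * K6 / 4"
  defines "A \<equiv> 1 + Y\<^sup>2 + 2 * s * ip + s\<^sup>2 * F\<^sup>2"
  shows "s * G\<^sup>2 \<le> 4 * A"
    and "A powr (p / 2) * (1 + p * (p - 1) / 2 * (s * G\<^sup>2 / A) + C * (s * G\<^sup>2 / A)\<^sup>2)
      \<le> exp (- (p * K6 / 2) * s) * (1 + Y\<^sup>2) powr (p / 2)"
proof -
  define v where "v = 1 + Y\<^sup>2"
  have v: "1 \<le> v" by (simp add: v_def)
  have Yv: "(1 + Y)\<^sup>2 \<le> 2 * v"
    using zero_le_power2[of "1 - Y"] by (simp add: v_def power2_eq_square algebra_simps)
  define w where "w = (2 * s * ip + s\<^sup>2 * F\<^sup>2) / v"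
  have "v * w = 2 * s * ip + s\<^sup>2 * F\<^sup>2" using v by (simp add: w_def)
  then have Aw: "A = v * (1 + w)" by (simp add: A_def v_def distrib_left)
  have sF2: "s\<^sup>2 * F\<^sup>2 \<le> 2 * e\<^sup>2 * v"
  proof -
    have "(s * F)\<^sup>2 \<le> (e * (1 + Y))\<^sup>2" using F s by (intro power_mono) auto
    also have "\<dots> \<le> e\<^sup>2 * (2 * v)" using Yv by (simp add: power_mult_distrib mult_left_mono)
    finally show ?thesis by (simp add: power_mult_distrib mult_ac)
  qed
  have sip: "\<bar>2 * s * ip\<bar> \<le> 4 * e * v"
  proof -
    have "\<bar>2 * s * ip\<bar> \<le> 2 * s * (Y * F)" using ip s by (simp add: abs_mult mult_left_mono)
    also have "\<dots> = 2 * Y * (s * F)" by simp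
    also have "\<dots> \<le> 2 * Y * (e * (1 + Y))" using F Y by (intro mult_left_mono) auto
    also have "\<dots> \<le> 2 * (1 + Y) * (e * (1 + Y))" using e Y by (intro mult_right_mono) auto
    also have "\<dots> = 2 * e * (1 + Y)\<^sup>2" by (simp add: power2_eq_square)
    also have "\<dots> \<le> 2 * e * (2 * v)" using Yv e by (intro mult_left_mono) auto
    finally show ?thesis by simp
  qed
  have e2: "e\<^sup>2 \<le> e" using e by (simp add: power2_eq_square mult_left_le)
  have w: "\<bar>w\<bar> \<le> 6 * e"
  proof -
    have "\<bar>2 * s * ip + s\<^sup>2 * F\<^sup>2\<bar> \<le> 4 * e * v + 2 * e\<^sup>2 * v"
      using sip sF2 abs_triangle_ineq[of "2 * s * ip" "s\<^sup>2 * F\<^sup>2"] by simp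
    also have "\<dots> \<le> 4 * e * v + 2 * e * v" using e2 v by simp
    finally have "\<bar>2 * s * ip + s\<^sup>2 * F\<^sup>2\<bar> \<le> 6 * e * v" by simp
    then show ?thesis using v by (simp add: w_def abs_divide divide_le_eq)
  qed
  then have w2: "- 1/2 \<le> w" "\<bar>w\<bar> \<le> 1/2" using e by linarith+
  define z where "z = s * G\<^sup>2 / v"
  have z: "0 \<le> z" "z \<le> 2 * e"
  proof -
    show "0 \<le> z" using s v by (simp add: z_def)
    have "s * G\<^sup>2 \<le> e * (2 * v)" using G Yv e by (meson mult_left_mono order_trans)
    then show "z \<le> 2 * e" using v by (simp add: z_def divide_le_eq mult_ac)
  qed
  define h where "h = s * G\<^sup>2 / A"
  have Apos: "0 < A" using v w2 by (auto simp: Aw intro!: mult_pos_pos)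
  have hz: "h = z / (1 + w)" using v by (simp add: h_def z_def Aw)
  have inv: "1 / (1 + w) \<le> 1 + 2 * \<bar>w\<bar>"
  proof -
    have "1 \<le> (1 + 2 * \<bar>w\<bar>) * (1 + w)"
    proof (cases "0 \<le> w")
      case True then show ?thesis by (simp add: algebra_simps)
    next
      case False
      have "0 \<le> - w * (1 + 2 * w)" using False w2 by (intro mult_nonneg_nonneg) auto
      then show ?thesis using False by (simp add: algebra_simps)
    qed
    then show ?thesis using w2 by (subst divide_le_eq) auto
  qed
  have h1: "h \<le> z + 24 * e\<^sup>2"
  proof -
    have "h \<le> z * (1 + 2 * \<bar>w\<bar>)" using mult_left_mono[OF inv z(1)] by (simp add: hz)
    also have "\<dots> = z + z * (2 * \<bar>w\<bar>)" by (simp add: algebra_simps)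
    also have "z * (2 * \<bar>w\<bar>) \<le> (2 * e) * (2 * (6 * e))"
      using z w e by (intro mult_mono) auto
    finally show ?thesis by (simp add: power2_eq_square)
  qed
  have h0: "0 \<le> h" using z w2 by (simp add: hz)
  have h2: "h \<le> 4 * e"
  proof -
    have "h \<le> z * (1 + 2 * \<bar>w\<bar>)" using mult_left_mono[OF inv z(1)] by (simp add: hz)
    also have "\<dots> \<le> (2 * e) * 2" using z w2 e by (intro mult_mono) auto
    finally show ?thesis by simp
  qed
  have hA: "s * G\<^sup>2 = h * A" using Apos by (simp add: h_def)
  have "h \<le> 4" using h2 e by linarith
  then show "s * G\<^sup>2 \<le> 4 * A" unfolding hA using Apos by (intro mult_right_mono) auto
  have "A powr (p / 2) * (1 + p * (p - 1) / 2 * h + C * h\<^sup>2)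
      \<le> (v powr (p / 2) * exp (p / 2 * w)) * exp (p * (p - 1) / 2 * z + (12 * p * (p - 1) + 16 * C) * e\<^sup>2)"
  proof (intro mult_mono)
    have "A powr (p / 2) = v powr (p / 2) * (1 + w) powr (p / 2)"
      using v w2 by (simp add: Aw powr_mult)
    also have "(1 + w) powr (p / 2) \<le> exp w powr (p / 2)"
      using w2 p by (intro powr_mono2 exp_ge_add_one_self) auto
    also have "exp w powr (p / 2) = exp (p / 2 * w)" by (simp add: powr_def)
    finally show "A powr (p / 2) \<le> v powr (p / 2) * exp (p / 2 * w)"
      by (simp add: mult_left_mono)
    have "C * h\<^sup>2 \<le> C * (4 * e)\<^sup>2" using C h0 h2 by (intro mult_left_mono power_mono) auto
    moreover have "p * (p - 1) / 2 * h \<le> p * (p - 1) / 2 * z + 12 * p * (p - 1) * e\<^sup>2"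
    proof -
      have "p * (p - 1) / 2 * h \<le> p * (p - 1) / 2 * (z + 24 * e\<^sup>2)"
        using p h1 by (intro mult_left_mono) auto
      then show ?thesis by (simp add: distrib_left)
    qed
    ultimately have "1 + p * (p - 1) / 2 * h + C * h\<^sup>2
        \<le> 1 + (p * (p - 1) / 2 * z + (12 * p * (p - 1) + 16 * C) * e\<^sup>2)"
      by (simp add: distrib_right power_mult_distrib)
    also have "\<dots> \<le> exp (p * (p - 1) / 2 * z + (12 * p * (p - 1) + 16 * C) * e\<^sup>2)"
      by (rule exp_ge_add_one_self)
    finally show "1 + p * (p - 1) / 2 * h + C * h\<^sup>2
        \<le> exp (p * (p - 1) / 2 * z + (12 * p * (p - 1) + 16 * C) * e\<^sup>2)" .
    show "0 \<le> 1 + p * (p - 1) / 2 * h + C * h\<^sup>2" using p h0 C by simp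
  qed simp
  also have "\<dots> = v powr (p / 2) * exp (p / 2 * w + (p * (p - 1) / 2 * z + (12 * p * (p - 1) + 16 * C) * e\<^sup>2))"
    by (simp add: exp_add)
  also have "\<dots> \<le> v powr (p / 2) * exp (- (p * K6 / 2) * s)"
  proof (intro mult_left_mono iffD2[OF exp_le_cancel_iff])
    have "p / 2 * w = p * s / v * ip + p / 2 * (s\<^sup>2 * F\<^sup>2 / v)"
      using v by (simp add: w_def field_simps)
    also have "s\<^sup>2 * F\<^sup>2 / v \<le> 2 * e\<^sup>2" using sF2 v by (simp add: divide_le_eq)
    finally have a: "p / 2 * w \<le> p * s / v * ip + p * e\<^sup>2" using p by simp
    have b: "p * (p - 1) / 2 * z = p * s / v * ((p - 1) / 2 * G\<^sup>2)" using v by (simp add: z_def field_simps)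
    have "p * s / v * ip + p * s / v * ((p - 1) / 2 * G\<^sup>2) \<le> p * s / v * (- K6 * Y\<^sup>2 + K7)"
      using coer p s v by (subst distrib_left[symmetric], intro mult_left_mono) auto
    also have "\<dots> = - p * K6 * s + s * (p * (K6 + K7) / v)"
      using v by (simp add: v_def field_simps add_nonneg_eq_0_iff)
    also have "\<dots> \<le> - p * K6 * s + s * (p * K6 / 4)"
      using Y_large s by (intro add_left_mono mult_left_mono) (auto simp: v_def)
    finally have c: "p * s / v * ip + p * s / v * ((p - 1) / 2 * G\<^sup>2) \<le> - p * K6 * s + s * (p * K6 / 4)" .
    have d: "(p + 12 * p * (p - 1) + 16 * C) * e\<^sup>2 = p * e\<^sup>2 + (12 * p * (p - 1) + 16 * C) * e\<^sup>2"
      by (simp add: algebra_simps)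
    have sum: "PW + (PZ + X) \<le> - (p * K6 / 2) * s"
      if "PW \<le> T1 + E" "PZ = T2" "T1 + T2 \<le> - p * K6 * s + s * (p * K6 / 4)" "E + X \<le> p * K6 / 4 * s"
      for PW PZ X T1 T2 E :: real
      using that by (simp add: algebra_simps)
    show "p / 2 * w + (p * (p - 1) / 2 * z + (12 * p * (p - 1) + 16 * C) * e\<^sup>2) \<le> - (p * K6 / 2) * s"
      by (rule sum[OF a b c]) (use d e(3) in simp)
  qed simp
  finally show "A powr (p / 2) * (1 + p * (p - 1) / 2 * (s * G\<^sup>2 / A) + C * (s * G\<^sup>2 / A)\<^sup>2)
      \<le> exp (- (p * K6 / 2) * s) * (1 + Y\<^sup>2) powr (p / 2)"
    by (simp only: h_def v_def mult.commute[of "exp _"])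
qed

text \<open>
  On a bounded time interval \<open>1 - exp(- lam s)\<close> is bounded below by a multiple of \<open>s\<close>, so growth that is
  linear in \<open>s\<close> can be charged to the inhomogeneous term of the contraction.
\<close>
lemma exp_growth_le_decay:
  fixes v v0 L lam T s :: real
  assumes "0 \<le> v" "v \<le> v0" "0 \<le> L" "0 < lam" "0 \<le> s" "s \<le> T"
  shows "v * exp (L * s) \<le> exp (- lam * s) * v
    + v0 * (L + lam) * exp (L * T) * exp (lam * T) / lam * (1 - exp (- lam * s))"
proof -
  have "exp (L * s) - exp (- lam * s) = exp (L * s) * (1 - exp (- ((L + lam) * s)))"
    by (simp add: algebra_simps flip: exp_add)
  also have "\<dots> \<le> exp (L * T) * ((L + lam) * s)"
  proof (intro mult_mono)
    show "1 - exp (- ((L + lam) * s)) \<le> (L + lam) * s"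
      using exp_ge_add_one_self[of "- ((L + lam) * s)"] by linarith
    have "0 \<le> (L + lam) * s" using assms by simp
    then show "0 \<le> 1 - exp (- ((L + lam) * s))" by (simp only: exp_le_one_iff diff_ge_0_iff_ge neg_le_0_iff_le)
  qed (use assms in \<open>auto intro: mult_left_mono\<close>)
  finally have a: "exp (L * s) - exp (- lam * s) \<le> exp (L * T) * ((L + lam) * s)" .
  have b: "lam * s \<le> exp (lam * T) * (1 - exp (- lam * s))"
  proof -
    have "lam * s \<le> exp (lam * s) - 1" using exp_ge_add_one_self[of "lam * s"] by linarith
    also have "\<dots> = exp (lam * s) * (1 - exp (- lam * s))"
      by (simp add: algebra_simps flip: exp_add)
    also have "\<dots> \<le> exp (lam * T) * (1 - exp (- lam * s))"
      using assms by (intro mult_right_mono) auto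
    finally show ?thesis .
  qed
  have "v * (exp (L * s) - exp (- lam * s)) \<le> v0 * (exp (L * T) * ((L + lam) * s))"
  proof (intro mult_mono)
    have "- (lam * s) \<le> L * s" using assms by (meson mult_nonneg_nonneg less_imp_le neg_le_0_iff_le order_trans)
    then show "0 \<le> exp (L * s) - exp (- lam * s)" by simp
  qed (use assms a in auto)
  also have "\<dots> = v0 * (L + lam) * exp (L * T) / lam * (lam * s)" using assms by simp
  also have "\<dots> \<le> v0 * (L + lam) * exp (L * T) / lam * (exp (lam * T) * (1 - exp (- lam * s)))"
    using assms b by (intro mult_left_mono) auto
  finally show ?thesis by (simp add: algebra_simps)
qed

locale adaptive_em =
  fixes f :: "real ^ 'd \<Rightarrow> real ^ 'd" and g :: "real ^ 'd \<Rightarrow> real ^ 'm ^ 'd"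
    and \<delta> :: "real ^ 'd \<Rightarrow> real" and p K6 K7 \<delta>max \<gamma> :: real
  assumes local_lipschitz: "\<And>R. R > 0 \<Longrightarrow> \<exists>C>0. \<forall>x y. max (norm x) (norm y) \<le> R \<longrightarrow>
      norm (f x - f y) + norm (g x - g y) \<le> C * norm (x - y)"
    and p_ge: "p \<ge> 2" and K6_pos: "K6 > 0"
    and coercive: "\<And>x. x \<bullet> f x + (p - 1) / 2 * (norm (g x))\<^sup>2 \<le> - K6 * (norm x)\<^sup>2 + K7"
    and step_pos: "\<And>x. 0 < \<delta> x" and step_le: "\<And>x. \<delta> x \<le> \<delta>max"
    and step_continuous: "continuous_on UNIV \<delta>"
    and step_vanishes: "(\<delta> \<longlongrightarrow> 0) at_infinity"
    and \<gamma>: "0 < \<gamma>" "\<gamma> \<le> 1 / 3"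
    and drift_step: "\<And>x. norm (f x) * \<delta> x powr \<gamma> \<le> 1 + norm x"
    and diffusion_step: "\<And>x. (norm (g x))\<^sup>2 * \<delta> x powr \<gamma> \<le> (1 + norm x)\<^sup>2"
begin

definition V :: "real ^ 'd \<Rightarrow> real" where "V x = (1 + (norm x)\<^sup>2) powr (p / 2)"

definition rate :: real where "rate = p * K6 / 2"

lemma rate_pos: "0 < rate" using p_ge K6_pos by (simp add: rate_def)

lemma V_nonneg [simp]: "0 \<le> V x" by (simp add: V_def)

lemma norm_powr_le_V: "norm x powr p \<le> V x"
proof -
  have "norm x powr p = ((norm x)\<^sup>2) powr (p / 2)"
    by (cases "x = 0") (auto simp: powr_powr simp flip: powr_numeral)
  also have "\<dots> \<le> V x" unfolding V_def using p_ge by (intro powr_mono2) auto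
  finally show ?thesis .
qed

lemma coefficients_continuous: "continuous_on UNIV f" "continuous_on UNIV g"
proof -
  have "isCont f x \<and> isCont g x" for x
  proof -
    obtain C where C: "C > 0" "\<And>x' y. max (norm x') (norm y) \<le> norm x + 1 \<Longrightarrow>
      norm (f x' - f y) + norm (g x' - g y) \<le> C * norm (x' - y)"
      using local_lipschitz[of "norm x + 1"] by (auto simp: add_nonneg_pos)
    have ev: "\<forall>\<^sub>F y in at x. norm (f y - f x) \<le> C * norm (y - x) \<and> norm (g y - g x) \<le> C * norm (y - x)"
    proof -
      have "\<forall>\<^sub>F y in at x. dist y x < 1" by (auto simp: eventually_at intro: exI[of _ 1])
      then show ?thesis
      proof eventually_elim
        case (elim y)
        have "norm y \<le> norm x + 1" using elim norm_triangle_sub[of y x] by (simp add: dist_norm)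
        then have "norm (f y - f x) + norm (g y - g x) \<le> C * norm (y - x)" by (intro C(2)) auto
        then show ?case using norm_ge_zero[of "f y - f x"] norm_ge_zero[of "g y - g x"] by linarith
      qed
    qed
    have lim: "((\<lambda>y. C * norm (y - x)) \<longlongrightarrow> 0) (at x)"
      by (rule tendsto_eq_intros refl | simp)+
    have "((\<lambda>y. f y - f x) \<longlongrightarrow> 0) (at x)" "((\<lambda>y. g y - g x) \<longlongrightarrow> 0) (at x)"
      by (rule Lim_null_comparison[OF _ lim], use ev in \<open>eventually_elim, simp\<close>)+
    then show ?thesis by (simp add: isCont_def LIM_zero_iff)
  qed
  then show "continuous_on UNIV f" "continuous_on UNIV g"
    by (simp_all add: continuous_at_imp_continuous_on)
qed

lemma coefficients_bounded:
  obtains B where "0 \<le> B" "\<And>x. norm x \<le> R \<Longrightarrow> norm (f x) \<le> B" "\<And>x. norm x \<le> R \<Longrightarrow> (norm (g x))\<^sup>2 \<le> B"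
proof -
  have "bounded ((\<lambda>x. norm (f x) + (norm (g x))\<^sup>2) ` cball 0 R)"
    by (intro compact_imp_bounded compact_continuous_image continuous_intros
        continuous_on_subset[OF coefficients_continuous(1)] continuous_on_subset[OF coefficients_continuous(2)]) auto
  then obtain B where "\<forall>z\<in>(\<lambda>x. norm (f x) + (norm (g x))\<^sup>2) ` cball 0 R. norm z \<le> B"
    unfolding bounded_iff by blast
  then have B: "\<bar>norm (f x) + (norm (g x))\<^sup>2\<bar> \<le> B" if "norm x \<le> R" for x
    using that by simp
  show thesis
  proof (rule that[of "\<bar>B\<bar>"])
    fix x :: "real ^ 'd" assume "norm x \<le> R"
    from B[OF this] show "norm (f x) \<le> \<bar>B\<bar>" "(norm (g x))\<^sup>2 \<le> \<bar>B\<bar>"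
      using norm_ge_zero[of "f x"] zero_le_power2[of "norm (g x)"] by linarith+
  qed simp
qed

text \<open>
  Far from the origin \<open>\<delta>\<close> is below any given threshold \<open>th ^ 3\<close>. With \<open>e = s powr (1 - \<gamma>)\<close> the condition
  \<open>\<gamma> \<le> 1/3\<close> gives \<open>e \<le> s powr (1/3) \<le> th\<close> and \<open>e\<^sup>2 = s * s powr (1 - 2 \<gamma>) \<le> th * s\<close>, which is what the scalar
  estimate asks for.
\<close>
lemma step_estimate_far:
  assumes C: "0 \<le> C"
  obtains R where "0 \<le> R" "\<And>y s. R \<le> norm y \<Longrightarrow> 0 \<le> s \<Longrightarrow> s \<le> \<delta> y \<Longrightarrow>
      s * (norm (g y))\<^sup>2 \<le> 4 * (1 + (norm (y + s *\<^sub>R f y))\<^sup>2) \<and>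
      V (y + s *\<^sub>R f y) *
        (1 + p * (p - 1) / 2 * (s * (norm (g y))\<^sup>2 / (1 + (norm (y + s *\<^sub>R f y))\<^sup>2))
          + C * (s * (norm (g y))\<^sup>2 / (1 + (norm (y + s *\<^sub>R f y))\<^sup>2))\<^sup>2)
      \<le> exp (- rate * s) * V y"
proof -
  define D where "D = p + 12 * p * (p - 1) + 16 * C"
  have D: "0 < D" using p_ge C unfolding D_def by (intro add_pos_nonneg) auto
  define th where "th = min (1 / 12) (p * K6 / (4 * D))"
  have th: "0 < th" "th \<le> 1 / 12" "D * th \<le> p * K6 / 4"
  proof -
    show "0 < th" "th \<le> 1 / 12" using D p_ge K6_pos by (auto simp: th_def)
    have "D * th \<le> D * (p * K6 / (4 * D))" using D by (intro mult_left_mono) (auto simp: th_def)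
    then show "D * th \<le> p * K6 / 4" using D by simp
  qed
  have "\<forall>\<^sub>F y in at_infinity. \<delta> y < th ^ 3"
    using order_tendstoD(2)[OF step_vanishes, of "th ^ 3"] th by simp
  then obtain R1 where R1: "\<And>y. R1 \<le> norm y \<Longrightarrow> \<delta> y < th ^ 3"
    by (auto simp: eventually_at_infinity)
  define R where "R = max \<bar>R1\<bar> (sqrt (4 * (K6 + K7) / K6))"
  show thesis
  proof (rule that[of R])
    show "0 \<le> R" by (simp add: R_def)
    fix y s assume y: "R \<le> norm y" and s: "0 \<le> s" "s \<le> \<delta> y"
    have small: "\<delta> y < th ^ 3" using y by (intro R1) (auto simp: R_def)
    define e where "e = s powr (1 - \<gamma>)"
    have e0: "0 \<le> e" by (simp add: e_def)
    have th1: "th ^ 3 \<le> 1" using th by (intro power_le_one) auto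
    have s1: "s \<le> 1" using s small th1 by linarith
    have sroot: "s powr (1 / 3) \<le> th"
    proof -
      have "s powr (1 / 3) \<le> (th ^ 3) powr (1 / 3)" using s small by (intro powr_mono2) auto
      also have "\<dots> = th" using th by (simp add: powr_powr flip: powr_numeral)
      finally show ?thesis .
    qed
    have e1: "e \<le> 1 / 12"
    proof -
      have "e \<le> s powr (1 / 3)" unfolding e_def using s s1 \<gamma> by (intro powr_mono') auto
      with sroot th show ?thesis by linarith
    qed
    have e2: "e\<^sup>2 \<le> th * s"
    proof -
      have "e\<^sup>2 = s powr (1 - 2 * \<gamma>) * s"
      proof (cases "s = 0")
        case False
        then have "e\<^sup>2 = s powr (2 - 2 * \<gamma>)"
          using s by (simp add: e_def powr_powr algebra_simps flip: powr_numeral)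
        also have "\<dots> = s powr ((1 - 2 * \<gamma>) + 1)" by simp
        also have "\<dots> = s powr (1 - 2 * \<gamma>) * s" using s False by (simp only: powr_add) simp
        finally show ?thesis .
      qed (simp add: e_def)
      also have "s powr (1 - 2 * \<gamma>) \<le> s powr (1 / 3)" using s s1 \<gamma> by (intro powr_mono') auto
      also have "\<dots> \<le> th" by (rule sroot)
      finally show ?thesis using s by (simp add: mult_right_mono)
    qed
    have se: "s = e * s powr \<gamma>"
      using s by (simp add: e_def flip: powr_add)
    have sd: "s powr \<gamma> \<le> \<delta> y powr \<gamma>" using s \<gamma> by (intro powr_mono2) auto
    have F: "s * norm (f y) \<le> e * (1 + norm y)"
    proof -
      have "norm (f y) * s powr \<gamma> \<le> norm (f y) * \<delta> y powr \<gamma>" using sd by (intro mult_left_mono) auto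
      also note drift_step[of y]
      finally have "e * (norm (f y) * s powr \<gamma>) \<le> e * (1 + norm y)" using e0 by (intro mult_left_mono)
      then show ?thesis by (subst se) (simp add: mult_ac)
    qed
    have G: "s * (norm (g y))\<^sup>2 \<le> e * (1 + norm y)\<^sup>2"
    proof -
      have "(norm (g y))\<^sup>2 * s powr \<gamma> \<le> (norm (g y))\<^sup>2 * \<delta> y powr \<gamma>" using sd by (intro mult_left_mono) auto
      also note diffusion_step[of y]
      finally have "e * ((norm (g y))\<^sup>2 * s powr \<gamma>) \<le> e * (1 + norm y)\<^sup>2" using e0 by (intro mult_left_mono)
      then show ?thesis by (subst se) (simp add: mult_ac)
    qed
    have De: "(p + 12 * p * (p - 1) + 16 * C) * e\<^sup>2 \<le> p * K6 / 4 * s"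
    proof -
      have "D * e\<^sup>2 \<le> D * (th * s)" using D e2 by (intro mult_left_mono) auto
      also have "\<dots> \<le> p * K6 / 4 * s" using mult_right_mono[OF th(3) s(1)] by (simp add: mult_ac)
      finally show ?thesis by (simp add: D_def)
    qed
    have large: "p * (K6 + K7) / (1 + (norm y)\<^sup>2) \<le> p * K6 / 4"
    proof -
      have "sqrt (4 * (K6 + K7) / K6) \<le> norm y" using y by (simp add: R_def)
      then have "4 * (K6 + K7) / K6 \<le> (norm y)\<^sup>2" by (simp add: sqrt_le_D)
      then have "K6 + K7 \<le> K6 / 4 * (norm y)\<^sup>2" using K6_pos by (simp add: field_simps)
      also have "\<dots> \<le> K6 / 4 * (1 + (norm y)\<^sup>2)" using K6_pos by simp
      finally have "p * (K6 + K7) \<le> p * (K6 / 4 * (1 + (norm y)\<^sup>2))" using p_ge by (intro mult_left_mono) auto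
      then show ?thesis by (simp add: divide_le_eq add_pos_nonneg mult_ac)
    qed
    have A: "1 + (norm (y + s *\<^sub>R f y))\<^sup>2 = 1 + (norm y)\<^sup>2 + 2 * s * (y \<bullet> f y) + s\<^sup>2 * (norm (f y))\<^sup>2"
      by (simp add: power2_norm_eq_inner inner_simps inner_commute algebra_simps power2_eq_square[of s])
    show "s * (norm (g y))\<^sup>2 \<le> 4 * (1 + (norm (y + s *\<^sub>R f y))\<^sup>2) \<and>
      V (y + s *\<^sub>R f y) *
        (1 + p * (p - 1) / 2 * (s * (norm (g y))\<^sup>2 / (1 + (norm (y + s *\<^sub>R f y))\<^sup>2))
          + C * (s * (norm (g y))\<^sup>2 / (1 + (norm (y + s *\<^sub>R f y))\<^sup>2))\<^sup>2)
      \<le> exp (- rate * s) * V y"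
      unfolding V_def rate_def A
      using exponential_decay_estimate[OF p_ge C K6_pos norm_ge_zero s(1) Cauchy_Schwarz_ineq2
          coercive norm_ge_zero F G e0 e1 De large] by blast
  qed
qed

text \<open>
  With bounded coefficients each factor is at most the exponential of a multiple of \<open>s\<close>; the division
  by \<open>1 + |y + s f y|\<^sup>2 \<ge> 1\<close> does no harm.
\<close>
lemma step_estimate_near:
  assumes B: "0 \<le> B" and C: "0 \<le> C"
  obtains L where "0 \<le> L" "\<And>y s. norm y \<le> R \<Longrightarrow> norm (f y) \<le> B \<Longrightarrow> (norm (g y))\<^sup>2 \<le> B \<Longrightarrow>
      0 \<le> s \<Longrightarrow> s \<le> \<delta>max \<Longrightarrow>
      V (y + s *\<^sub>R f y) *
        (1 + p * (p - 1) / 2 * (s * (norm (g y))\<^sup>2 / (1 + (norm (y + s *\<^sub>R f y))\<^sup>2))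
          + C * (s * (norm (g y))\<^sup>2 / (1 + (norm (y + s *\<^sub>R f y))\<^sup>2))\<^sup>2)
      \<le> V y * exp (L * s)"
proof -
  have dm: "0 \<le> \<delta>max" using step_pos[of 0] step_le[of 0] by simp
  define L1 where "L1 = 2 * \<bar>R\<bar> * B + \<delta>max * B\<^sup>2"
  define L2 where "L2 = p * (p - 1) / 2 * B + C * \<delta>max * B\<^sup>2"
  show thesis
  proof (rule that[of "p / 2 * L1 + L2"])
    show "0 \<le> p / 2 * L1 + L2" unfolding L1_def L2_def using p_ge B C dm by simp
    fix y s assume y: "norm y \<le> R" "norm (f y) \<le> B" "(norm (g y))\<^sup>2 \<le> B" and s: "0 \<le> s" "s \<le> \<delta>max"
    define A where "A = 1 + (norm (y + s *\<^sub>R f y))\<^sup>2"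
    have A1: "1 \<le> A" by (simp add: A_def)
    define h where "h = s * (norm (g y))\<^sup>2 / A"
    have h: "0 \<le> h" "h \<le> s * B"
    proof -
      show "0 \<le> h" using s A1 by (simp add: h_def)
      have "h \<le> s * (norm (g y))\<^sup>2" unfolding h_def using s A1 divide_left_mono[of 1 A "s * (norm (g y))\<^sup>2"] by simp
      also have "\<dots> \<le> s * B" using y s by (intro mult_left_mono)
      finally show "h \<le> s * B" .
    qed
    have "A = 1 + (norm y)\<^sup>2 + 2 * s * (y \<bullet> f y) + s\<^sup>2 * (norm (f y))\<^sup>2"
      by (simp add: A_def power2_norm_eq_inner inner_simps inner_commute algebra_simps power2_eq_square[of s])
    also have "\<dots> \<le> 1 + (norm y)\<^sup>2 + 2 * s * (\<bar>R\<bar> * B) + s * \<delta>max * B\<^sup>2"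
    proof (intro add_mono mult_left_mono)
      have "y \<bullet> f y \<le> norm y * norm (f y)" by (rule norm_cauchy_schwarz)
      also have "\<dots> \<le> \<bar>R\<bar> * B" using y by (intro mult_mono) auto
      finally show "y \<bullet> f y \<le> \<bar>R\<bar> * B" .
      show "s\<^sup>2 * (norm (f y))\<^sup>2 \<le> s * \<delta>max * B\<^sup>2"
        using s y unfolding power2_eq_square[of s] by (intro mult_mono power_mono) auto
    qed (use s in auto)
    also have "\<dots> = 1 + (norm y)\<^sup>2 + s * L1" by (simp add: L1_def algebra_simps)
    also have "s * L1 \<le> (1 + (norm y)\<^sup>2) * (s * L1)"
    proof -
      have "0 \<le> s * L1" unfolding L1_def using s B dm by simp
      then show ?thesis using mult_right_mono[of 1 "1 + (norm y)\<^sup>2" "s * L1"] by simp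
    qed
    finally have "A \<le> (1 + (norm y)\<^sup>2) * (1 + s * L1)" by (simp add: algebra_simps)
    also have "\<dots> \<le> (1 + (norm y)\<^sup>2) * exp (s * L1)"
      by (intro mult_left_mono exp_ge_add_one_self) auto
    finally have "A powr (p / 2) \<le> ((1 + (norm y)\<^sup>2) * exp (s * L1)) powr (p / 2)"
      using A1 p_ge by (intro powr_mono2) auto
    also have "\<dots> = V y * exp (p / 2 * (s * L1))"
      by (simp add: V_def powr_mult) (simp add: powr_def)
    finally have a: "A powr (p / 2) \<le> V y * exp (p / 2 * (s * L1))" .
    have "C * h\<^sup>2 \<le> C * (s * \<delta>max * B\<^sup>2)"
    proof (rule mult_left_mono[OF _ C])
      have "h\<^sup>2 \<le> (s * B)\<^sup>2" using h by (intro power_mono)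
      also have "\<dots> = s * s * B\<^sup>2" by (simp add: power2_eq_square)
      also have "\<dots> \<le> s * \<delta>max * B\<^sup>2" using s by (intro mult_mono) auto
      finally show "h\<^sup>2 \<le> s * \<delta>max * B\<^sup>2" .
    qed
    moreover have "p * (p - 1) / 2 * h \<le> p * (p - 1) / 2 * (s * B)" using p_ge h by (intro mult_left_mono) auto
    moreover have "p * (p - 1) / 2 * (s * B) + C * (s * \<delta>max * B\<^sup>2) = s * L2"
      by (simp add: L2_def algebra_simps)
    ultimately have "1 + p * (p - 1) / 2 * h + C * h\<^sup>2 \<le> 1 + s * L2"
      by linarith
    also have "\<dots> \<le> exp (s * L2)" by (rule exp_ge_add_one_self)
    finally have b: "1 + p * (p - 1) / 2 * h + C * h\<^sup>2 \<le> exp (s * L2)" .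
    have "A powr (p / 2) * (1 + p * (p - 1) / 2 * h + C * h\<^sup>2) \<le> V y * exp (p / 2 * (s * L1)) * exp (s * L2)"
      using a b p_ge h C by (intro mult_mono) auto
    also have "\<dots> = V y * exp ((p / 2 * L1 + L2) * s)"
      by (simp add: algebra_simps flip: exp_add)
    finally show "V (y + s *\<^sub>R f y) *
        (1 + p * (p - 1) / 2 * (s * (norm (g y))\<^sup>2 / (1 + (norm (y + s *\<^sub>R f y))\<^sup>2))
          + C * (s * (norm (g y))\<^sup>2 / (1 + (norm (y + s *\<^sub>R f y))\<^sup>2))\<^sup>2)
      \<le> V y * exp ((p / 2 * L1 + L2) * s)"
      by (simp add: V_def A_def h_def)
  qed
qed

text \<open>
  The moment bound is used twice, because its constant depends on the bound on the noise-to-state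
  ratio: far out this ratio is at most \<open>4\<close>, which fixes \<open>C1\<close> and then the radius \<open>R\<close>; only then is the
  bound \<open>\<delta>max * B\<close> on the ball of radius \<open>R\<close> known.
\<close>
lemma one_step_contraction:
  assumes "isotropic_noise (\<mu> :: (real ^ 'm) measure)"
  obtains C where "0 \<le> C" "\<And>y s. 0 \<le> s \<Longrightarrow> s \<le> \<delta> y \<Longrightarrow>
    (\<integral>\<^sup>+z. ennreal (V (y + s *\<^sub>R f y + g y *v (sqrt s *\<^sub>R z))) \<partial>\<mu>)
      \<le> ennreal (exp (- rate * s) * V y + C * (1 - exp (- rate * s)))"
proof -
  interpret isotropic_noise \<mu> by fact
  have dm: "0 \<le> \<delta>max" using step_pos[of 0] step_le[of 0] by simp
  note moment = symmetric_noise_moment_le[where 'd = 'd, OF p_ge]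
  have norm_sc: "(norm (sqrt s *\<^sub>R g y))\<^sup>2 = s * (norm (g y))\<^sup>2" if "0 \<le> s" for s y
    using that by (simp add: power_mult_distrib)
  have sc: "(sqrt s *\<^sub>R g y) *v z = g y *v (sqrt s *\<^sub>R z)" for s y z
    by (simp add: vec_eq_iff matrix_vector_mul_component)
  obtain C1 where C1: "0 \<le> C1" "\<And>y s. 0 \<le> s \<Longrightarrow> s * (norm (g y))\<^sup>2 \<le> 4 * (1 + (norm (y + s *\<^sub>R f y))\<^sup>2) \<Longrightarrow>
      (\<integral>\<^sup>+z. ennreal (V (y + s *\<^sub>R f y + g y *v (sqrt s *\<^sub>R z))) \<partial>\<mu>)
      \<le> ennreal (V (y + s *\<^sub>R f y) *
        (1 + p * (p - 1) / 2 * (s * (norm (g y))\<^sup>2 / (1 + (norm (y + s *\<^sub>R f y))\<^sup>2))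
          + C1 * (s * (norm (g y))\<^sup>2 / (1 + (norm (y + s *\<^sub>R f y))\<^sup>2))\<^sup>2))"
  proof (rule moment[of 4])
    fix C1 assume C1: "0 \<le> C1" and *: "\<And>(a :: real ^ 'd) (G :: real ^ 'm ^ 'd). (norm G)\<^sup>2 \<le> 4 * (1 + (norm a)\<^sup>2) \<Longrightarrow>
      (\<integral>\<^sup>+z. ennreal ((1 + (norm (a + G *v z))\<^sup>2) powr (p / 2)) \<partial>\<mu>)
      \<le> ennreal ((1 + (norm a)\<^sup>2) powr (p / 2) *
          (1 + p * (p - 1) / 2 * ((norm G)\<^sup>2 / (1 + (norm a)\<^sup>2))
            + C1 * ((norm G)\<^sup>2 / (1 + (norm a)\<^sup>2))\<^sup>2))"
    show thesis
    proof (rule that[OF C1])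
      fix y s assume s: "0 \<le> (s::real)" and le: "s * (norm (g y))\<^sup>2 \<le> 4 * (1 + (norm (y + s *\<^sub>R f y))\<^sup>2)"
      show "(\<integral>\<^sup>+z. ennreal (V (y + s *\<^sub>R f y + g y *v (sqrt s *\<^sub>R z))) \<partial>\<mu>)
      \<le> ennreal (V (y + s *\<^sub>R f y) *
        (1 + p * (p - 1) / 2 * (s * (norm (g y))\<^sup>2 / (1 + (norm (y + s *\<^sub>R f y))\<^sup>2))
          + C1 * (s * (norm (g y))\<^sup>2 / (1 + (norm (y + s *\<^sub>R f y))\<^sup>2))\<^sup>2))"
        unfolding V_def using *[of "sqrt s *\<^sub>R g y" "y + s *\<^sub>R f y"] le
        by (simp only: norm_sc[OF s] sc)
    qed
  qed simp
  obtain R where R: "0 \<le> R" "\<And>y s. R \<le> norm y \<Longrightarrow> 0 \<le> s \<Longrightarrow> s \<le> \<delta> y \<Longrightarrow>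
      s * (norm (g y))\<^sup>2 \<le> 4 * (1 + (norm (y + s *\<^sub>R f y))\<^sup>2) \<and>
      V (y + s *\<^sub>R f y) *
        (1 + p * (p - 1) / 2 * (s * (norm (g y))\<^sup>2 / (1 + (norm (y + s *\<^sub>R f y))\<^sup>2))
          + C1 * (s * (norm (g y))\<^sup>2 / (1 + (norm (y + s *\<^sub>R f y))\<^sup>2))\<^sup>2)
      \<le> exp (- rate * s) * V y"
    using step_estimate_far[OF C1(1)] by blast
  obtain B where B: "0 \<le> B" "\<And>x. norm x \<le> R \<Longrightarrow> norm (f x) \<le> B" "\<And>x. norm x \<le> R \<Longrightarrow> (norm (g x))\<^sup>2 \<le> B"
    using coefficients_bounded[of R] by blast
  obtain C2 where C2: "0 \<le> C2" "\<And>y s. 0 \<le> s \<Longrightarrow> s * (norm (g y))\<^sup>2 \<le> \<delta>max * B * (1 + (norm (y + s *\<^sub>R f y))\<^sup>2) \<Longrightarrow>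
      (\<integral>\<^sup>+z. ennreal (V (y + s *\<^sub>R f y + g y *v (sqrt s *\<^sub>R z))) \<partial>\<mu>)
      \<le> ennreal (V (y + s *\<^sub>R f y) *
        (1 + p * (p - 1) / 2 * (s * (norm (g y))\<^sup>2 / (1 + (norm (y + s *\<^sub>R f y))\<^sup>2))
          + C2 * (s * (norm (g y))\<^sup>2 / (1 + (norm (y + s *\<^sub>R f y))\<^sup>2))\<^sup>2))"
  proof (rule moment[of "\<delta>max * B"])
    fix C2 assume C2: "0 \<le> C2" and *: "\<And>(a :: real ^ 'd) (G :: real ^ 'm ^ 'd). (norm G)\<^sup>2 \<le> \<delta>max * B * (1 + (norm a)\<^sup>2) \<Longrightarrow>
      (\<integral>\<^sup>+z. ennreal ((1 + (norm (a + G *v z))\<^sup>2) powr (p / 2)) \<partial>\<mu>)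
      \<le> ennreal ((1 + (norm a)\<^sup>2) powr (p / 2) *
          (1 + p * (p - 1) / 2 * ((norm G)\<^sup>2 / (1 + (norm a)\<^sup>2))
            + C2 * ((norm G)\<^sup>2 / (1 + (norm a)\<^sup>2))\<^sup>2))"
    show thesis
    proof (rule that[OF C2])
      fix y s assume s: "0 \<le> (s::real)" and le: "s * (norm (g y))\<^sup>2 \<le> \<delta>max * B * (1 + (norm (y + s *\<^sub>R f y))\<^sup>2)"
      show "(\<integral>\<^sup>+z. ennreal (V (y + s *\<^sub>R f y + g y *v (sqrt s *\<^sub>R z))) \<partial>\<mu>)
      \<le> ennreal (V (y + s *\<^sub>R f y) *
        (1 + p * (p - 1) / 2 * (s * (norm (g y))\<^sup>2 / (1 + (norm (y + s *\<^sub>R f y))\<^sup>2))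
          + C2 * (s * (norm (g y))\<^sup>2 / (1 + (norm (y + s *\<^sub>R f y))\<^sup>2))\<^sup>2))"
        unfolding V_def using *[of "sqrt s *\<^sub>R g y" "y + s *\<^sub>R f y"] le
        by (simp only: norm_sc[OF s] sc)
    qed
  qed (use dm B in simp)
  obtain L where L: "0 \<le> L" "\<And>y s. norm y \<le> R \<Longrightarrow> norm (f y) \<le> B \<Longrightarrow> (norm (g y))\<^sup>2 \<le> B \<Longrightarrow>
      0 \<le> s \<Longrightarrow> s \<le> \<delta>max \<Longrightarrow>
      V (y + s *\<^sub>R f y) *
        (1 + p * (p - 1) / 2 * (s * (norm (g y))\<^sup>2 / (1 + (norm (y + s *\<^sub>R f y))\<^sup>2))
          + C2 * (s * (norm (g y))\<^sup>2 / (1 + (norm (y + s *\<^sub>R f y))\<^sup>2))\<^sup>2)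
      \<le> V y * exp (L * s)"
    using step_estimate_near[OF B(1) C2(1)] by blast
  define v0 where "v0 = (1 + R\<^sup>2) powr (p / 2)"
  define C where "C = v0 * (L + rate) * exp (L * \<delta>max) * exp (rate * \<delta>max) / rate"
  have C0: "0 \<le> C" unfolding C_def v0_def using L rate_pos by simp
  show thesis
  proof (rule that[OF C0])
    fix y s assume s: "0 \<le> s" "s \<le> \<delta> y"
    have sdm: "s \<le> \<delta>max" using s step_le[of y] by simp
    show "(\<integral>\<^sup>+z. ennreal (V (y + s *\<^sub>R f y + g y *v (sqrt s *\<^sub>R z))) \<partial>\<mu>)
      \<le> ennreal (exp (- rate * s) * V y + C * (1 - exp (- rate * s)))"
    proof (cases "R \<le> norm y")
      case True
      have "0 \<le> C * (1 - exp (- rate * s))" using C0 s rate_pos by simp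
      then show ?thesis
        using C1(2)[OF s(1)] R(2)[OF True s] by (meson add_increasing2 ennreal_leI order_trans)
    next
      case False
      then have y: "norm y \<le> R" by simp
      have "s * (norm (g y))\<^sup>2 \<le> \<delta>max * B * 1" using s sdm B(3)[OF y] by (simp add: mult_mono)
      also have "\<dots> \<le> \<delta>max * B * (1 + (norm (y + s *\<^sub>R f y))\<^sup>2)"
        using dm B by (intro mult_left_mono) auto
      finally have "(\<integral>\<^sup>+z. ennreal (V (y + s *\<^sub>R f y + g y *v (sqrt s *\<^sub>R z))) \<partial>\<mu>) \<le> ennreal (V y * exp (L * s))"
        using C2(2)[OF s(1)] L(2)[OF y B(2)[OF y] B(3)[OF y] s(1) sdm] by (meson ennreal_leI order_trans)
      also have "V y * exp (L * s) \<le> exp (- rate * s) * V y + C * (1 - exp (- rate * s))"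
        unfolding C_def
      proof (rule exp_growth_le_decay)
        show "V y \<le> v0" unfolding V_def v0_def using y p_ge by (intro powr_mono2 add_left_mono power_mono) auto
      qed (use L s sdm rate_pos in auto)
      finally show ?thesis by (simp add: ennreal_leI)
    qed
  qed
qed

end

section \<open>Standard Gaussian vectors\<close>

definition std_gaussian :: "(real ^ 'm) measure" where
  "std_gaussian = distr (\<Pi>\<^sub>M i\<in>UNIV. density lborel std_normal_density) borel (\<lambda>x. \<chi> i. x i)"

lemma measurable_vec_lambda:
  assumes "\<And>i. (\<lambda>\<omega>. h \<omega> i) \<in> borel_measurable N"
  shows "(\<lambda>\<omega>. \<chi> i. h \<omega> i) \<in> N \<rightarrow>\<^sub>M (borel :: (real ^ 'm) measure)"
proof (subst borel_measurable_euclidean_space, intro ballI)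
  fix b :: "real ^ 'm" assume "b \<in> Basis"
  then obtain i where "b = axis i 1" by (auto simp: Basis_vec_def)
  then show "(\<lambda>\<omega>. (\<chi> i. h \<omega> i) \<bullet> b) \<in> borel_measurable N"
    using assms[of i] by (simp add: inner_axis)
qed

lemma borel_measurable_vec_nth [measurable]:
  "(\<lambda>x :: 'b :: euclidean_space ^ 'n. x $ i) \<in> borel_measurable borel"
  by (intro borel_measurable_continuous_onI continuous_intros)

lemma measurable_matrix_vector_mult_pair [measurable]:
  assumes [measurable]: "A \<in> N \<rightarrow>\<^sub>M (borel :: (real ^ 'm ^ 'd) measure)" "z \<in> N \<rightarrow>\<^sub>M (borel :: (real ^ 'm) measure)"
  shows "(\<lambda>\<omega>. A \<omega> *v z \<omega>) \<in> N \<rightarrow>\<^sub>M borel"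
proof -
  have "(\<lambda>\<omega>. (\<chi> k. A \<omega> $ k \<bullet> z \<omega>)) \<in> N \<rightarrow>\<^sub>M (borel :: (real ^ 'd) measure)"
    by (rule measurable_vec_lambda; measurable)
  moreover have "A \<omega> *v z \<omega> = (\<chi> k. A \<omega> $ k \<bullet> z \<omega>)" for \<omega>
    by (simp add: vec_eq_iff matrix_vector_mul_component)
  ultimately show ?thesis by simp
qed

lemma tendsto_matrix_vector_mult:
  fixes G :: "real ^ 'm ^ 'd"
  assumes "(z \<longlongrightarrow> l) F"
  shows "((\<lambda>k. G *v z k) \<longlongrightarrow> G *v l) F"
  by (rule bounded_linear.tendsto[OF matrix_vector_mul_bounded_linear assms])

text \<open>
  The law of a vector with independent standard normal components is determined. Applied to \<open>Z\<close> and
  to \<open>- Z\<close> it yields the reflection symmetry of the Gaussian law, and applied to rescaled Brownian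
  increments it identifies all of them with one fixed law.
\<close>
lemma (in prob_space) standard_normal_vector_law:
  fixes Z :: "'a \<Rightarrow> real ^ 'm"
  assumes indep: "indep_vars (\<lambda>_. borel) (\<lambda>i \<omega>. Z \<omega> $ i) UNIV"
    and normal: "\<And>i. distributed M lborel (\<lambda>\<omega>. Z \<omega> $ i) std_normal_density"
  shows "Z \<in> M \<rightarrow>\<^sub>M borel" "distr M borel Z = std_gaussian"
proof -
  have comp [measurable]: "(\<lambda>\<omega>. Z \<omega> $ i) \<in> borel_measurable M" for i
    using distributed_measurable[OF normal[of i]] by simp
  have "(\<lambda>\<omega>. \<chi> i. Z \<omega> $ i) \<in> M \<rightarrow>\<^sub>M borel" by (rule measurable_vec_lambda) simp
  then show Zm: "Z \<in> M \<rightarrow>\<^sub>M borel" by simp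
  have dens: "distr M borel (\<lambda>\<omega>. Z \<omega> $ i) = density lborel std_normal_density" for i
  proof -
    have "distr M borel (\<lambda>\<omega>. Z \<omega> $ i) = distr M lborel (\<lambda>\<omega>. Z \<omega> $ i)" by (rule distr_cong) auto
    then show ?thesis using distributed_distr_eq_density[OF normal[of i]] by simp
  qed
  have "distr M (\<Pi>\<^sub>M i\<in>UNIV. borel) (\<lambda>x. \<lambda>i\<in>UNIV. Z x $ i) = (\<Pi>\<^sub>M i\<in>UNIV. distr M borel (\<lambda>\<omega>. Z \<omega> $ i))"
    using indep by (subst (asm) indep_vars_iff_distr_eq_PiM) auto
  also have "\<dots> = (\<Pi>\<^sub>M i\<in>UNIV. density lborel std_normal_density)" by (simp add: dens)
  finally have "std_gaussian = distr (distr M (\<Pi>\<^sub>M i\<in>UNIV. borel) (\<lambda>x. \<lambda>i\<in>UNIV. Z x $ i)) borel (\<lambda>x. \<chi> i. x i)"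
    by (simp add: std_gaussian_def)
  also have "\<dots> = distr M borel Z"
  proof -
    have "(\<lambda>x. \<lambda>i\<in>UNIV. Z x $ i) \<in> M \<rightarrow>\<^sub>M (\<Pi>\<^sub>M i\<in>UNIV. borel)"
      by (rule measurable_restrict) simp
    moreover have "(\<lambda>x. \<chi> i. x i) \<in> (\<Pi>\<^sub>M i\<in>UNIV. borel) \<rightarrow>\<^sub>M (borel :: (real ^ 'm) measure)"
      by (rule measurable_vec_lambda) measurable
    ultimately show ?thesis
      by (subst distr_distr) (auto simp: o_def restrict_UNIV vec_lambda_eta)
  qed
  finally show "distr M borel Z = std_gaussian" by simp
qed

lemma (in prob_space) std_normal_component:
  assumes X: "distributed M lborel X std_normal_density"
  shows "integrable M (\<lambda>\<omega>. \<bar>X \<omega>\<bar> ^ n)" "expectation X = 0" "(\<integral>\<omega>. X \<omega> * X \<omega> \<partial>M) = 1"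
    "integrable M X"
proof -
  have [measurable]: "X \<in> borel_measurable M" using distributed_measurable[OF X] by simp
  show "integrable M (\<lambda>\<omega>. \<bar>X \<omega>\<bar> ^ n)"
    using distributed_integrable[OF X, of "\<lambda>x. \<bar>x\<bar> ^ n"] integrable_std_normal_moment_abs by simp
  show "integrable M X"
    using distributed_integrable[OF X, of "\<lambda>x. x"] integrable_std_normal_moment[of 1] by simp
  show "expectation X = 0"
    using distributed_integral[OF X, of "\<lambda>x. x"] integral_std_normal_moment_odd[of 0] by simp
  show "(\<integral>\<omega>. X \<omega> * X \<omega> \<partial>M) = 1"
    using distributed_integral[OF X, of "\<lambda>x. x * x"] integral_std_normal_moment_even[of 1]
    by (simp add: power2_eq_square)
qed

text \<open>
  The properties of \<open>std_gaussian\<close> are read off from any vector \<open>Z\<close> that has this law, because there the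
  hypotheses on the components can be used directly.
\<close>
lemma (in prob_space) std_gaussian_isotropic_noise:
  fixes Z :: "'a \<Rightarrow> real ^ 'm"
  assumes indep: "indep_vars (\<lambda>_. borel) (\<lambda>i \<omega>. Z \<omega> $ i) UNIV"
    and normal: "\<And>i. distributed M lborel (\<lambda>\<omega>. Z \<omega> $ i) std_normal_density"
  shows "isotropic_noise (std_gaussian :: (real ^ 'm) measure)"
proof -
  note law = standard_normal_vector_law[OF indep normal]
  note [measurable] = law(1)
  interpret Z: prob_space "std_gaussian :: (real ^ 'm) measure"
    unfolding law(2)[symmetric] by (rule prob_space_distr) measurable
  have law_minus: "distr M borel (\<lambda>\<omega>. - Z \<omega>) = std_gaussian"
  proof (rule standard_normal_vector_law(2))
    show "indep_vars (\<lambda>_. borel) (\<lambda>i \<omega>. (- Z \<omega>) $ i) UNIV"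
      using indep_vars_compose2[OF indep, of "\<lambda>_. uminus" "\<lambda>_. borel"] by simp
    show "distributed M lborel (\<lambda>\<omega>. (- Z \<omega>) $ i) std_normal_density" for i
      using normal_density_affine[OF normal[of i], of "-1" 0] by simp
  qed
  have integrable_norm: "integrable M (\<lambda>\<omega>. norm (Z \<omega>) ^ n)" for n
  proof (rule Bochner_Integration.integrable_bound)
    show "integrable M (\<lambda>\<omega>. real CARD('m) ^ n * (\<Sum>i\<in>UNIV. \<bar>Z \<omega> $ i\<bar> ^ n))"
      by (intro integrable_mult_right Bochner_Integration.integrable_sum std_normal_component normal)
    show "AE \<omega> in M. norm (norm (Z \<omega>) ^ n) \<le> norm (real CARD('m) ^ n * (\<Sum>i\<in>UNIV. \<bar>Z \<omega> $ i\<bar> ^ n))"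
    proof (intro AE_I2)
      fix \<omega>
      define m where "m = Max (range (\<lambda>i. \<bar>Z \<omega> $ i\<bar>))"
      have le: "\<bar>Z \<omega> $ i\<bar> \<le> m" for i unfolding m_def by (intro Max_ge) auto
      have "m \<in> range (\<lambda>i. \<bar>Z \<omega> $ i\<bar>)" unfolding m_def by (intro Max_in) auto
      then obtain k where k: "m = \<bar>Z \<omega> $ k\<bar>" by auto
      have "norm (Z \<omega>) \<le> (\<Sum>i\<in>UNIV. \<bar>Z \<omega> $ i\<bar>)" by (rule norm_le_l1_cart)
      also have "\<dots> \<le> real CARD('m) * m" using le by (intro sum_bounded_above) auto
      finally have "norm (Z \<omega>) ^ n \<le> (real CARD('m) * m) ^ n" by (intro power_mono) auto
      also have "\<dots> = real CARD('m) ^ n * m ^ n" by (simp add: power_mult_distrib)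
      also have "m ^ n \<le> (\<Sum>i\<in>UNIV. \<bar>Z \<omega> $ i\<bar> ^ n)"
        unfolding k by (rule member_le_sum) auto
      finally show "norm (norm (Z \<omega>) ^ n) \<le> norm (real CARD('m) ^ n * (\<Sum>i\<in>UNIV. \<bar>Z \<omega> $ i\<bar> ^ n))"
        by (simp add: mult_left_mono abs_mult sum_nonneg)
    qed
  qed measurable
  have cov: "(\<integral>\<omega>. Z \<omega> $ i * Z \<omega> $ j \<partial>M) = (if i = j then 1 else 0)" for i j
  proof (cases "i = j")
    case True then show ?thesis using std_normal_component(3)[OF normal[of j]] by simp
  next
    case False
    have "(\<integral>\<omega>. (\<Prod>k\<in>{i, j}. Z \<omega> $ k) \<partial>M) = (\<Prod>k\<in>{i, j}. expectation (\<lambda>\<omega>. Z \<omega> $ k))"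
      by (rule indep_vars_lebesgue_integral)
         (auto intro: indep_vars_subset[OF indep] std_normal_component(4) normal)
    then show ?thesis using False std_normal_component(2)[OF normal] by simp
  qed
  have comp [measurable]: "(\<lambda>z :: real ^ 'm. z $ i) \<in> borel_measurable borel" for i
    by (intro borel_measurable_continuous_onI continuous_intros)
  show ?thesis
  proof
    show "sets (std_gaussian :: (real ^ 'm) measure) = sets borel" by (simp add: std_gaussian_def)
    have "distr std_gaussian borel uminus = distr M borel (\<lambda>\<omega>. - Z \<omega>)"
      unfolding law(2)[symmetric] by (subst distr_distr) (auto simp: o_def)
    then show "distr std_gaussian borel uminus = (std_gaussian :: (real ^ 'm) measure)"
      by (simp add: law_minus)
    show "(\<integral>z. z $ i * z $ j \<partial>std_gaussian) = (if i = j then 1 else 0)" for i j :: 'm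
      unfolding law(2)[symmetric] using cov[of i j] by (subst integral_distr) auto
    show "integrable std_gaussian (\<lambda>z :: real ^ 'm. norm z ^ n)" for n
      unfolding law(2)[symmetric] using integrable_norm[of n] by (subst integrable_distr_eq) auto
  qed
qed

section \<open>Evaluating a process at a random time\<close>

lemma ceiling_grid_tendsto:
  fixes x :: real
  shows "(\<lambda>k. of_int \<lceil>real (Suc k) * x\<rceil> / real (Suc k)) \<longlonglongrightarrow> x"
proof (rule real_tendsto_sandwich)
  show "\<forall>\<^sub>F k in sequentially. x \<le> of_int \<lceil>real (Suc k) * x\<rceil> / real (Suc k)"
    by (intro always_eventually allI) (simp add: le_divide_eq mult.commute le_of_int_ceiling)
  show "\<forall>\<^sub>F k in sequentially. of_int \<lceil>real (Suc k) * x\<rceil> / real (Suc k) \<le> x + 1 / real (Suc k)"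
  proof (intro always_eventually allI)
    fix k
    have "of_int \<lceil>real (Suc k) * x\<rceil> \<le> real (Suc k) * x + 1" by (rule of_int_ceiling_le_add_one)
    also have "\<dots> = (x + 1 / real (Suc k)) * real (Suc k)" by (simp add: field_simps)
    finally show "of_int \<lceil>real (Suc k) * x\<rceil> / real (Suc k) \<le> x + 1 / real (Suc k)"
      by (subst divide_le_eq) simp
  qed
  show "(\<lambda>k. x + 1 / real (Suc k)) \<longlonglongrightarrow> x"
    using tendsto_add[OF tendsto_const[of x] LIMSEQ_inverse_real_of_nat] by (simp add: inverse_eq_divide)
qed simp

lemma floor_grid_tendsto:
  fixes x :: real
  shows "(\<lambda>k. of_int \<lfloor>real (Suc k) * x\<rfloor> / real (Suc k)) \<longlonglongrightarrow> x"
  using tendsto_minus[OF ceiling_grid_tendsto[of "- x"]] by (simp add: ceiling_minus)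

lemma continuous_path_tendsto:
  fixes w :: "real \<Rightarrow> 'b :: topological_space"
  assumes "continuous_on {0..} w" "s \<longlonglongrightarrow> l" "0 \<le> l" "\<And>k. 0 \<le> s k"
  shows "(\<lambda>k. w (s k)) \<longlonglongrightarrow> w l"
  by (rule continuous_on_tendsto_compose[OF assms(1,2)]) (use assms in auto)

text \<open>
  Approximating \<open>R\<close> by the grid times \<open>ceiling (k R) / k\<close> leaves, for each \<open>k\<close>, a process selected by a
  countable-valued index; continuity of the paths gives the limit. The \<open>max 0\<close> only keeps the times
  inside the domain of continuity for negative index values, which do not occur on \<open>space G\<close>.
\<close>
lemma measurable_path_at_random_time:
  fixes w :: "real \<Rightarrow> 'a \<Rightarrow> 'b :: {metric_space, second_countable_topology}"
  assumes meas: "\<And>q. 0 \<le> q \<Longrightarrow> w q \<in> G \<rightarrow>\<^sub>M borel"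
    and cont: "\<And>\<omega>. \<omega> \<in> space G \<Longrightarrow> continuous_on {0..} (\<lambda>q. w q \<omega>)"
    and R [measurable]: "R \<in> borel_measurable G" and R0: "\<And>\<omega>. \<omega> \<in> space G \<Longrightarrow> 0 \<le> R \<omega>"
  shows "(\<lambda>\<omega>. w (R \<omega>) \<omega>) \<in> G \<rightarrow>\<^sub>M borel"
proof (rule borel_measurable_LIMSEQ_metric)
  fix k :: nat
  have "(\<lambda>\<omega>. (\<lambda>(i :: int) \<omega>. w (max 0 (of_int i / real (Suc k))) \<omega>) \<lceil>real (Suc k) * R \<omega>\<rceil> \<omega>) \<in> G \<rightarrow>\<^sub>M borel"
    by (rule measurable_compose_countable[where f = "\<lambda>(i :: int) \<omega>. w (max 0 (of_int i / real (Suc k))) \<omega>"])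
       (auto intro: meas)
  then show "(\<lambda>\<omega>. w (max 0 (of_int \<lceil>real (Suc k) * R \<omega>\<rceil> / real (Suc k))) \<omega>) \<in> G \<rightarrow>\<^sub>M borel" by simp
next
  fix \<omega> assume \<omega>: "\<omega> \<in> space G"
  have "(\<lambda>k. max 0 (of_int \<lceil>real (Suc k) * R \<omega>\<rceil> / real (Suc k))) \<longlonglongrightarrow> max 0 (R \<omega>)"
    by (intro tendsto_max tendsto_const ceiling_grid_tendsto)
  then show "(\<lambda>k. w (max 0 (of_int \<lceil>real (Suc k) * R \<omega>\<rceil> / real (Suc k))) \<omega>) \<longlonglongrightarrow> w (R \<omega>) \<omega>"
    using R0[OF \<omega>] by (intro continuous_path_tendsto[OF cont[OF \<omega>]]) auto
qed

text \<open>
  In a complete measure space, a \<open>\<sigma>\<close>-algebra that contains all null sets does not see changes on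
  null sets. This is how the usual conditions make up for paths that are only almost surely
  continuous.
\<close>
lemma (in complete_measure) measurable_AE_cong:
  assumes G: "null_sets M \<subseteq> sets G" "space G = space M"
    and h: "h \<in> G \<rightarrow>\<^sub>M N" and AE: "AE \<omega> in M. h \<omega> = h' \<omega>"
    and sp: "\<And>\<omega>. \<omega> \<in> space M \<Longrightarrow> h' \<omega> \<in> space N"
  shows "h' \<in> G \<rightarrow>\<^sub>M N"
proof (rule measurableI)
  fix A assume A: "A \<in> sets N"
  define D where "D = {\<omega> \<in> space M. h \<omega> \<noteq> h' \<omega>}"
  have D: "D \<in> null_sets M" using AE by (simp add: AE_iff_null_sets D_def)
  have "h' -` A \<inter> D \<in> null_sets M" by (rule complete2[OF _ D]) auto
  then have "(h -` A \<inter> space G - D) \<union> (h' -` A \<inter> D) \<in> sets G"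
    using D G measurable_sets[OF h A] by blast
  moreover have "(h -` A \<inter> space G - D) \<union> (h' -` A \<inter> D) = h' -` A \<inter> space G"
    by (auto simp: D_def G)
  ultimately show "h' -` A \<inter> space G \<in> sets G" by simp
qed (use G sp in simp)

lemma (in complete_measure) measurable_AE_path_at_random_time:
  fixes w :: "real \<Rightarrow> 'a \<Rightarrow> 'b :: {metric_space, second_countable_topology}"
  assumes G: "null_sets M \<subseteq> sets G" "space G = space M"
    and meas: "\<And>q. 0 \<le> q \<Longrightarrow> w q \<in> G \<rightarrow>\<^sub>M borel"
    and cont: "AE \<omega> in M. continuous_on {0..} (\<lambda>q. w q \<omega>)"
    and R: "R \<in> borel_measurable G" and R0: "\<And>\<omega>. \<omega> \<in> space M \<Longrightarrow> 0 \<le> R \<omega>"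
  shows "(\<lambda>\<omega>. w (R \<omega>) \<omega>) \<in> G \<rightarrow>\<^sub>M borel"
proof -
  define D where "D = {\<omega> \<in> space M. \<not> continuous_on {0..} (\<lambda>q. w q \<omega>)}"
  have D: "D \<in> null_sets M" using cont by (simp add: AE_iff_null_sets D_def)
  define w' where "w' q \<omega> = (if \<omega> \<in> D then undefined else w q \<omega>)" for q \<omega>
  have "(\<lambda>\<omega>. w' (R \<omega>) \<omega>) \<in> G \<rightarrow>\<^sub>M borel"
  proof (rule measurable_path_at_random_time[OF _ _ R])
    show "w' q \<in> G \<rightarrow>\<^sub>M borel" if "0 \<le> q" for q
      unfolding w'_def[abs_def] using meas[OF that] D G by (intro measurable_If_set) auto
    show "continuous_on {0..} (\<lambda>q. w' q \<omega>)" if "\<omega> \<in> space G" for \<omega>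
      using that G by (cases "\<omega> \<in> D") (auto simp: w'_def D_def)
  qed (use R0 G in simp)
  then show ?thesis
  proof (rule measurable_AE_cong[OF G])
    show "AE \<omega> in M. w' (R \<omega>) \<omega> = w (R \<omega>) \<omega>"
      using AE_not_in[OF D] by eventually_elim (simp add: w'_def)
  qed simp
qed

section \<open>Brownian increments over random intervals\<close>

context brownian_motion
begin

abbreviation FF :: "real \<Rightarrow> 'a measure" where "FF \<equiv> \<lambda>t. F (max 0 t)"

lemma sets_F_subset: "0 \<le> t \<Longrightarrow> sets (F t) \<subseteq> sets M"
  using subalg[of t] by (simp add: subalgebra_def)

lemma space_F_eq: "0 \<le> t \<Longrightarrow> space (F t) = space M"
  using subalg[of t] by (simp add: subalgebra_def)

lemma measurable_F_imp_M: "0 \<le> t \<Longrightarrow> h \<in> F t \<rightarrow>\<^sub>M N \<Longrightarrow> h \<in> M \<rightarrow>\<^sub>M N"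
  using measurable_from_subalg[OF subalg] by blast

lemma measurable_W: "0 \<le> t \<Longrightarrow> W t \<in> M \<rightarrow>\<^sub>M borel"
  using measurable_F_imp_M[OF _ adapted] by blast

lemma normalised_increment:
  assumes "0 \<le> u" "0 < r"
  shows "indep_vars (\<lambda>_. borel) (\<lambda>i \<omega>. ((1 / sqrt r) *\<^sub>R (W (u + r) \<omega> - W u \<omega>)) $ i) UNIV"
    "distributed M lborel (\<lambda>\<omega>. ((1 / sqrt r) *\<^sub>R (W (u + r) \<omega> - W u \<omega>)) $ i) std_normal_density"
proof -
  show "indep_vars (\<lambda>_. borel) (\<lambda>i \<omega>. ((1 / sqrt r) *\<^sub>R (W (u + r) \<omega> - W u \<omega>)) $ i) UNIV"
    using indep_vars_compose2[OF increments_indep_components[of u "u + r"], of "\<lambda>_ x. (1 / sqrt r) * x" "\<lambda>_. borel"] assms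
    by simp
  show "distributed M lborel (\<lambda>\<omega>. ((1 / sqrt r) *\<^sub>R (W (u + r) \<omega> - W u \<omega>)) $ i) std_normal_density"
    using normal_density_affine[OF increments_normal[of u "u + r" i], of "1 / sqrt r" 0] assms by simp
qed

lemma gaussian_noise: "isotropic_noise (std_gaussian :: (real ^ 'm) measure)"
  by (rule std_gaussian_isotropic_noise[OF normalised_increment[of 0 1]]) auto

lemma increment_law:
  assumes "0 \<le> u" "0 < r"
  shows "distr M borel (\<lambda>\<omega>. W (u + r) \<omega> - W u \<omega>) = distr std_gaussian borel (\<lambda>z. sqrt r *\<^sub>R z)"
proof -
  note law = standard_normal_vector_law[OF normalised_increment[OF assms]]
  show ?thesis
    unfolding law(2)[symmetric] using assms law(1) by (subst distr_distr) (auto simp: o_def)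
qed

text \<open>
  For deterministic times: given \<open>F u\<close>, the increment can be integrated out with everything known at
  time \<open>u\<close> held fixed.
\<close>
lemma independent_increment_integral:
  assumes u: "0 \<le> u" "0 \<le> r" and Q [measurable]: "Q \<in> F u \<rightarrow>\<^sub>M N"
    and H [measurable]: "(\<lambda>(q, z). H q z) \<in> borel_measurable (N \<Otimes>\<^sub>M borel)"
  shows "(\<integral>\<^sup>+\<omega>. H (Q \<omega>) (W (u + r) \<omega> - W u \<omega>) \<partial>M) = (\<integral>\<^sup>+\<omega>. (\<integral>\<^sup>+z. H (Q \<omega>) (sqrt r *\<^sub>R z) \<partial>std_gaussian) \<partial>M)"
proof -
  interpret noise: isotropic_noise "std_gaussian :: (real ^ 'm) measure" by (rule gaussian_noise)
  have QM [measurable]: "Q \<in> M \<rightarrow>\<^sub>M N" by (rule measurable_F_imp_M[OF u(1) Q])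
  show ?thesis
  proof (cases "r = 0")
    case True
    then show ?thesis using noise.emeasure_space_1 by (simp add: nn_integral_const)
  next
    case False
    with u have r: "0 < r" by simp
    define Z where "Z \<omega> = W (u + r) \<omega> - W u \<omega>" for \<omega>
    have [measurable]: "W (u + r) \<in> M \<rightarrow>\<^sub>M borel" "W u \<in> M \<rightarrow>\<^sub>M borel" using u by (auto intro: measurable_W)
    have Zm [measurable]: "Z \<in> M \<rightarrow>\<^sub>M borel" unfolding Z_def[abs_def] by measurable
    interpret dQ: prob_space "distr M N Q" by (rule prob_space_distr) simp
    interpret dZ: prob_space "distr M borel Z" by (rule prob_space_distr) simp
    have joint: "distr M N Q \<Otimes>\<^sub>M distr M borel Z = distr M (N \<Otimes>\<^sub>M borel) (\<lambda>\<omega>. (Q \<omega>, Z \<omega>))"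
    proof (rule pair_measure_eqI[OF dQ.sigma_finite_measure_axioms dZ.sigma_finite_measure_axioms])
      show "sets (distr M N Q \<Otimes>\<^sub>M distr M borel Z) = sets (distr M (N \<Otimes>\<^sub>M borel) (\<lambda>\<omega>. (Q \<omega>, Z \<omega>)))"
        by (simp add: sets_pair_measure_cong[OF sets_distr sets_distr])
      fix A B assume "A \<in> sets (distr M N Q)" "B \<in> sets (distr M borel Z)"
      then have AB [measurable]: "A \<in> sets N" "B \<in> sets borel" by auto
      have "Q -` A \<inter> space M \<in> sets (F u)"
        using measurable_sets[OF Q AB(1)] by (simp add: space_F_eq[OF u(1)])
      moreover have "Z -` B \<inter> space M \<in> sets (vimage_algebra (space M) Z borel)"
        using AB(2) by (rule in_vimage_algebra)
      moreover have "indep_set (sets (F u)) (sets (vimage_algebra (space M) Z borel))"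
        using increments_indep_past[of u "u + r"] u r by (simp add: Z_def[abs_def])
      ultimately have "prob ((Q -` A \<inter> space M) \<inter> (Z -` B \<inter> space M)) = prob (Q -` A \<inter> space M) * prob (Z -` B \<inter> space M)"
        unfolding indep_sets2_eq by blast
      moreover have "(\<lambda>\<omega>. (Q \<omega>, Z \<omega>)) -` (A \<times> B) \<inter> space M = (Q -` A \<inter> space M) \<inter> (Z -` B \<inter> space M)" by auto
      ultimately show "emeasure (distr M N Q) A * emeasure (distr M borel Z) B
          = emeasure (distr M (N \<Otimes>\<^sub>M borel) (\<lambda>\<omega>. (Q \<omega>, Z \<omega>))) (A \<times> B)"
        by (simp add: emeasure_distr emeasure_eq_measure ennreal_mult)
    qed
    have H' [measurable]: "(\<lambda>(q, z). H q z) \<in> borel_measurable (distr M N Q \<Otimes>\<^sub>M distr M borel Z)"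
      by (subst measurable_cong_sets[OF sets_pair_measure_cong refl]) auto
    have "(\<integral>\<^sup>+\<omega>. H (Q \<omega>) (Z \<omega>) \<partial>M) = (\<integral>\<^sup>+x. (\<lambda>(q, z). H q z) x \<partial>(distr M (N \<Otimes>\<^sub>M borel) (\<lambda>\<omega>. (Q \<omega>, Z \<omega>))))"
      by (subst nn_integral_distr) auto
    also have "\<dots> = (\<integral>\<^sup>+q. (\<integral>\<^sup>+z. H q z \<partial>distr M borel Z) \<partial>distr M N Q)"
      unfolding joint[symmetric] by (subst dZ.nn_integral_fst[symmetric]) auto
    also have "\<dots> = (\<integral>\<^sup>+\<omega>. (\<integral>\<^sup>+z. H (Q \<omega>) z \<partial>distr M borel Z) \<partial>M)"
      using dZ.borel_measurable_nn_integral_fst[OF H'] by (subst nn_integral_distr) auto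
    also have "\<dots> = (\<integral>\<^sup>+\<omega>. (\<integral>\<^sup>+z. H (Q \<omega>) (sqrt r *\<^sub>R z) \<partial>std_gaussian) \<partial>M)"
    proof (rule nn_integral_cong)
      fix \<omega> assume "\<omega> \<in> space M"
      then have [measurable]: "H (Q \<omega>) \<in> borel_measurable borel"
        using measurable_Pair2[OF H, of "Q \<omega>"] measurable_space[OF QM] by simp
      show "(\<integral>\<^sup>+z. H (Q \<omega>) z \<partial>distr M borel Z) = (\<integral>\<^sup>+z. H (Q \<omega>) (sqrt r *\<^sub>R z) \<partial>std_gaussian)"
        unfolding Z_def increment_law[OF u(1) r] by (subst nn_integral_distr) auto
    qed
    finally show ?thesis by (simp add: Z_def)
  qed
qed

text \<open>
  An event known at the stopping time \<open>T\<close> on which \<open>T \<le> u\<close> is known at time \<open>u\<close>; this and the next lemma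
  transport data from a random to a deterministic time.
\<close>
lemma pre_sigma_localise:
  assumes T: "stopping_time FF T" and A: "A \<in> sets (pre_sigma T)" and u: "0 \<le> u"
    and le: "\<And>\<omega>. \<omega> \<in> A \<Longrightarrow> T \<omega> \<le> u"
  shows "A \<in> sets (F u)"
proof -
  have "{\<omega> \<in> A. T \<omega> \<le> u} \<in> sets (FF u)" by (rule sets_pre_sigmaD[OF T A])
  moreover have "{\<omega> \<in> A. T \<omega> \<le> u} = A" using le by auto
  ultimately show ?thesis using u by simp
qed

lemma measurable_pre_sigma_localise:
  assumes T: "stopping_time FF T" and X: "X \<in> pre_sigma T \<rightarrow>\<^sub>M N"
    and B: "B \<in> sets (pre_sigma T)" and u: "0 \<le> u" and le: "\<And>\<omega>. \<omega> \<in> B \<Longrightarrow> T \<omega> \<le> u"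
    and c: "c \<in> space N"
  shows "(\<lambda>\<omega>. if \<omega> \<in> B then X \<omega> else c) \<in> F u \<rightarrow>\<^sub>M N"
proof (rule measurableI)
  have Bu: "B \<in> sets (F u)" by (rule pre_sigma_localise[OF T B u le])
  show "(if \<omega> \<in> B then X \<omega> else c) \<in> space N" if "\<omega> \<in> space (F u)" for \<omega>
    using that measurable_space[OF X, of \<omega>] c u by (simp add: space_pre_sigma space_F_eq)
  fix A assume A: "A \<in> sets N"
  have "X -` A \<inter> space (pre_sigma T) \<inter> B \<in> sets (pre_sigma T)"
    using measurable_sets[OF X A] B by (rule sets.Int)
  then have "X -` A \<inter> space (pre_sigma T) \<inter> B \<in> sets (F u)"
    by (rule pre_sigma_localise[OF T _ u]) (use le in auto)
  moreover have "(\<lambda>\<omega>. if \<omega> \<in> B then X \<omega> else c) -` A \<inter> space (F u)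
      = X -` A \<inter> space (pre_sigma T) \<inter> B \<union> (if c \<in> A then space (F u) - B else {})"
    using sets.sets_into_space[OF B] by (auto simp: space_pre_sigma space_F_eq[OF u] split: if_splits)
  ultimately show "(\<lambda>\<omega>. if \<omega> \<in> B then X \<omega> else c) -` A \<inter> space (F u) \<in> sets (F u)"
    using Bu by auto
qed

lemma pre_sigma_subset: "stopping_time FF T \<Longrightarrow> (\<And>\<omega>. \<omega> \<in> space M \<Longrightarrow> 0 \<le> T \<omega>) \<Longrightarrow> A \<in> sets (pre_sigma T) \<Longrightarrow> A \<in> sets M"
proof -
  assume T: "stopping_time FF T" and A: "A \<in> sets (pre_sigma T)"
  have AM: "A \<subseteq> space M" using sets.sets_into_space[OF A] by (simp add: space_pre_sigma)
  have "{\<omega> \<in> A. T \<omega> \<le> real n} \<in> sets M" for n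
    using sets_pre_sigmaD[OF T A, of "real n"] sets_F_subset[of "real n"] by auto
  then have "(\<Union>n. {\<omega> \<in> A. T \<omega> \<le> real n}) \<in> sets M" by blast
  moreover have "(\<Union>n. {\<omega> \<in> A. T \<omega> \<le> real n}) = A" using real_arch_simple by auto
  ultimately show "A \<in> sets M" by simp
qed

lemma measurable_pre_sigma_imp_M:
  assumes T: "stopping_time FF T" and T0: "\<And>\<omega>. \<omega> \<in> space M \<Longrightarrow> 0 \<le> T \<omega>" and X: "X \<in> pre_sigma T \<rightarrow>\<^sub>M N"
  shows "X \<in> M \<rightarrow>\<^sub>M N"
proof (rule measurableI)
  show "X \<omega> \<in> space N" if "\<omega> \<in> space M" for \<omega>
    using that measurable_space[OF X, of \<omega>] by (simp add: space_pre_sigma)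
  show "X -` A \<inter> space M \<in> sets M" if "A \<in> sets N" for A
    using pre_sigma_subset[OF T T0 measurable_sets[OF X that]] by (simp add: space_pre_sigma)
qed

lemma null_sets_F: "0 \<le> t \<Longrightarrow> null_sets M \<subseteq> sets (F t)"
  using null_sets_F0 sets_F_mono[of 0 t] by auto

text \<open>
  On the event \<open>T \<le> t\<close> the value \<open>W T\<close> is that of the stopped process \<open>W (min q t)\<close> at the time
  \<open>min T t\<close>, and all of that is measurable with respect to \<open>F t\<close>.
\<close>
lemma measurable_pre_sigma_W:
  assumes T: "stopping_time FF T" and T0: "\<And>\<omega>. \<omega> \<in> space M \<Longrightarrow> 0 \<le> T \<omega>"
  shows "(\<lambda>\<omega>. W (T \<omega>) \<omega>) \<in> pre_sigma T \<rightarrow>\<^sub>M borel"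
proof (rule measurableI)
  fix A :: "(real ^ 'm) set" assume A: "A \<in> sets borel"
  show "(\<lambda>\<omega>. W (T \<omega>) \<omega>) -` A \<inter> space (pre_sigma T) \<in> sets (pre_sigma T)"
  proof (rule sets_pre_sigmaI[OF T])
    fix t :: real
    show "{\<omega> \<in> (\<lambda>\<omega>. W (T \<omega>) \<omega>) -` A \<inter> space (pre_sigma T). T \<omega> \<le> t} \<in> sets (FF t)"
    proof (cases "0 \<le> t")
      case False
      then have empty: "{\<omega> \<in> (\<lambda>\<omega>. W (T \<omega>) \<omega>) -` A \<inter> space (pre_sigma T). T \<omega> \<le> t} = {}"
        using T0 by (force simp: space_pre_sigma)
      show ?thesis unfolding empty by simp
    next
      case True
      have R: "(\<lambda>\<omega>. min (T \<omega>) t) \<in> borel_measurable (F t)"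
      proof (rule borel_measurableI_le)
        fix c
        have "{\<omega> \<in> space (F t). T \<omega> \<le> c} \<in> sets (F t)" if "c \<le> t"
          using stopping_time_le_const[OF T that] True by (simp add: pred_def)
        then show "{\<omega> \<in> space (F t). min (T \<omega>) t \<le> c} \<in> sets (F t)"
          by (cases "c < t") (auto simp: min_le_iff_disj)
      qed
      have "(\<lambda>\<omega>. (\<lambda>q. W (min q t)) (min (T \<omega>) t) \<omega>) \<in> F t \<rightarrow>\<^sub>M borel"
      proof (rule measurable_AE_path_at_random_time[OF null_sets_F[OF True] space_F_eq[OF True] _ _ R])
        show "W (min q t) \<in> F t \<rightarrow>\<^sub>M borel" if "0 \<le> q" for q
        proof (rule measurable_mono[THEN subsetD, OF order_refl refl _ _ adapted])
          show "sets (F (min q t)) \<subseteq> sets (F t)" using sets_F_mono[of "min q t" t] that True by simp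
        qed (use that True in \<open>auto simp: space_F_eq\<close>)
        show "AE \<omega> in M. continuous_on {0..} (\<lambda>q. W (min q t) \<omega>)"
          using continuous_paths
        proof eventually_elim
          case (elim \<omega>)
          show ?case
            by (rule continuous_on_compose2[OF elim, of _ "\<lambda>q. min q t"]) (use True in \<open>auto intro!: continuous_intros\<close>)
        qed
      qed (use T0 True in auto)
      then have "(\<lambda>\<omega>. W (min (T \<omega>) t) \<omega>) -` A \<inter> space (F t) \<in> sets (F t)"
        using measurable_sets[OF _ A] by simp
      moreover have "{\<omega> \<in> space (F t). T \<omega> \<le> t} \<in> sets (F t)"
        using stopping_timeD[OF T, of t] True by (simp add: pred_def)
      ultimately have "((\<lambda>\<omega>. W (min (T \<omega>) t) \<omega>) -` A \<inter> space (F t)) \<inter> {\<omega> \<in> space (F t). T \<omega> \<le> t} \<in> sets (F t)"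
        by (rule sets.Int)
      also have "((\<lambda>\<omega>. W (min (T \<omega>) t) \<omega>) -` A \<inter> space (F t)) \<inter> {\<omega> \<in> space (F t). T \<omega> \<le> t}
          = {\<omega> \<in> (\<lambda>\<omega>. W (T \<omega>) \<omega>) -` A \<inter> space (pre_sigma T). T \<omega> \<le> t}"
        by (auto simp: space_pre_sigma space_F_eq[OF True])
      finally show ?thesis using True by simp
    qed
  qed
qed simp

lemma measurable_W_random_time:
  assumes "R \<in> borel_measurable M" "\<And>\<omega>. \<omega> \<in> space M \<Longrightarrow> 0 \<le> R \<omega>"
  shows "(\<lambda>\<omega>. W (R \<omega>) \<omega>) \<in> M \<rightarrow>\<^sub>M borel"
  by (rule measurable_AE_path_at_random_time[OF _ refl measurable_W continuous_paths assms]) auto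

text \<open>
  A substitute for the strong Markov property. The start \<open>T\<close> is rounded up to \<open>Tk\<close>, so that on each
  event where \<open>Tk\<close> is constant everything known at \<open>T\<close> is known at the deterministic time \<open>Tk\<close>; the length \<open>r\<close>
  is rounded down to \<open>rk\<close>, so that the hypothesis, which covers all \<open>s \<le> r\<close>, still applies. Since
  the bound \<open>v\<close> does not involve the rounding, no convergence is needed on the right-hand side, and on
  the left Fatou's lemma suffices.
\<close>
lemma random_time_step_le:
  fixes X :: "'a \<Rightarrow> 'b" and H :: "'b \<Rightarrow> real \<Rightarrow> real ^ 'm \<Rightarrow> real" and v :: "'b \<Rightarrow> ennreal"
  assumes T: "stopping_time FF T" and T0: "\<And>\<omega>. \<omega> \<in> space M \<Longrightarrow> 0 \<le> T \<omega>"
    and X [measurable]: "X \<in> pre_sigma T \<rightarrow>\<^sub>M N"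
    and r [measurable]: "r \<in> borel_measurable (pre_sigma T)" and r0: "\<And>\<omega>. \<omega> \<in> space M \<Longrightarrow> 0 \<le> r \<omega>"
    and H [measurable]: "(\<lambda>(x, s, z). H x s z) \<in> borel_measurable (N \<Otimes>\<^sub>M borel \<Otimes>\<^sub>M borel)"
    and H_cont: "\<And>x sk s zk z. x \<in> space N \<Longrightarrow> sk \<longlonglongrightarrow> s \<Longrightarrow> zk \<longlonglongrightarrow> z \<Longrightarrow>
      (\<lambda>k. H x (sk k) (zk k)) \<longlonglongrightarrow> H x s z"
    and v [measurable]: "v \<in> borel_measurable N"
    and le: "\<And>\<omega> s. \<omega> \<in> space M \<Longrightarrow> 0 \<le> s \<Longrightarrow> s \<le> r \<omega> \<Longrightarrow>
      (\<integral>\<^sup>+z. ennreal (H (X \<omega>) s (sqrt s *\<^sub>R z)) \<partial>std_gaussian) \<le> v (X \<omega>)"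
  shows "(\<integral>\<^sup>+\<omega>. ennreal (H (X \<omega>) (r \<omega>) (W (T \<omega> + r \<omega>) \<omega> - W (T \<omega>) \<omega>)) \<partial>M) \<le> (\<integral>\<^sup>+\<omega>. v (X \<omega>) \<partial>M)"
proof -
  interpret noise: isotropic_noise "std_gaussian :: (real ^ 'm) measure" by (rule gaussian_noise)
  note pM = measurable_pre_sigma_imp_M[OF T T0]
  have [measurable]: "T \<in> borel_measurable (pre_sigma T)" by (rule measurable_stopping_time_pre_sigma[OF T])
  have [measurable]: "X \<in> M \<rightarrow>\<^sub>M N" "r \<in> borel_measurable M" "T \<in> borel_measurable M"
    by (auto intro: pM)
  define Tk where "Tk k \<omega> = of_int \<lceil>real (Suc k) * T \<omega>\<rceil> / real (Suc k)" for k \<omega>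
  define rk where "rk k \<omega> = of_int \<lfloor>real (Suc k) * r \<omega>\<rfloor> / real (Suc k)" for k \<omega>
  have Tk0: "0 \<le> Tk k \<omega>" and rk0: "0 \<le> rk k \<omega>" if "\<omega> \<in> space M" for k \<omega>
  proof -
    have "0 \<le> \<lceil>real (Suc k) * T \<omega>\<rceil>" using T0[OF that] by (simp add: order_less_le_trans[of "-1" 0])
    then show "0 \<le> Tk k \<omega>" by (simp add: Tk_def)
    have "0 \<le> \<lfloor>real (Suc k) * r \<omega>\<rfloor>" using r0[OF that] by simp
    then show "0 \<le> rk k \<omega>" by (simp add: rk_def)
  qed
  have T_le: "T \<omega> \<le> Tk k \<omega>" for k \<omega>
    by (simp add: Tk_def le_divide_eq mult.commute le_of_int_ceiling)
  have rk_le: "rk k \<omega> \<le> r \<omega>" for k \<omega>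
    by (simp add: rk_def divide_le_eq mult.commute of_int_floor_le)
  have [measurable]: "Tk k \<in> borel_measurable M" "rk k \<in> borel_measurable M" for k
    unfolding Tk_def[abs_def] rk_def[abs_def] by measurable
  define I where "I k \<omega> = ennreal (H (X \<omega>) (rk k \<omega>) (W (Tk k \<omega> + rk k \<omega>) \<omega> - W (Tk k \<omega>) \<omega>))" for k \<omega>
  have [measurable]: "(\<lambda>\<omega>. W (Tk k \<omega> + rk k \<omega>) \<omega>) \<in> M \<rightarrow>\<^sub>M borel" "(\<lambda>\<omega>. W (Tk k \<omega>) \<omega>) \<in> M \<rightarrow>\<^sub>M borel" for k
    by (rule measurable_W_random_time; use Tk0 rk0 in \<open>auto intro: add_nonneg_nonneg\<close>)+
  have I_meas [measurable]: "I k \<in> borel_measurable M" for k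
  proof -
    have "(\<lambda>\<omega>. (\<lambda>(x, s, z). H x s z) (X \<omega>, rk k \<omega>, W (Tk k \<omega> + rk k \<omega>) \<omega> - W (Tk k \<omega>) \<omega>)) \<in> borel_measurable M"
      by (rule measurable_compose[OF _ H]) measurable
    then show ?thesis unfolding I_def[abs_def] by simp
  qed
  have discrete: "(\<integral>\<^sup>+\<omega>. I k \<omega> \<partial>M) \<le> (\<integral>\<^sup>+\<omega>. v (X \<omega>) \<partial>M)" for k
  proof -
    \<comment> \<open>The events on which both rounded quantities are constant, numbered by a natural number.\<close>
    define c where "c \<omega> = (\<lceil>real (Suc k) * T \<omega>\<rceil>, \<lfloor>real (Suc k) * r \<omega>\<rfloor>)" for \<omega>
    define B where "B m = {\<omega> \<in> space M. to_nat (c \<omega>) = m}" for m :: nat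
    have B_pre: "B m \<in> sets (pre_sigma T)" for m
    proof -
      have "{\<omega> \<in> space (pre_sigma T). to_nat (c \<omega>) = m} \<in> sets (pre_sigma T)"
        unfolding c_def by measurable
      then show ?thesis by (simp add: B_def space_pre_sigma)
    qed
    have B_M [measurable]: "B m \<in> sets M" for m using pre_sigma_subset[OF T T0 B_pre] by blast
    have disj: "disjoint_family B" by (auto simp: disjoint_family_on_def B_def)
    have Un: "(\<Union>m. B m) = space M" by (auto simp: B_def)
    have split: "(\<integral>\<^sup>+\<omega>. h \<omega> \<partial>M) = (\<Sum>m. \<integral>\<^sup>+\<omega>\<in>B m. h \<omega> \<partial>M)"
      if [measurable]: "h \<in> borel_measurable M" for h :: "'a \<Rightarrow> ennreal"
    proof -
      have "(\<integral>\<^sup>+\<omega>. h \<omega> \<partial>M) = (\<integral>\<^sup>+\<omega>\<in>(\<Union>m. B m). h \<omega> \<partial>M)"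
        unfolding Un by (intro nn_integral_cong) simp
      also have "\<dots> = (\<Sum>m. \<integral>\<^sup>+\<omega>\<in>B m. h \<omega> \<partial>M)"
        by (rule nn_integral_disjoint_family[OF _ _ disj]) auto
      finally show ?thesis .
    qed
    have piece: "(\<integral>\<^sup>+\<omega>\<in>B m. I k \<omega> \<partial>M) \<le> (\<integral>\<^sup>+\<omega>\<in>B m. v (X \<omega>) \<partial>M)" for m
    proof (cases "B m = {}")
      case True then show ?thesis by simp
    next
      case False
      then obtain \<omega>0 where \<omega>0: "\<omega>0 \<in> B m" by auto
      then have \<omega>0M: "\<omega>0 \<in> space M" by (simp add: B_def)
      define u where "u = Tk k \<omega>0"
      define s where "s = rk k \<omega>0"
      have us: "0 \<le> u" "0 \<le> s" using Tk0 rk0 \<omega>0M by (auto simp: u_def s_def)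
      have const: "Tk k \<omega> = u" "rk k \<omega> = s" if "\<omega> \<in> B m" for \<omega>
      proof -
        have "to_nat (c \<omega>) = to_nat (c \<omega>0)" using that \<omega>0 by (simp add: B_def)
        then have "c \<omega> = c \<omega>0" by simp
        then show "Tk k \<omega> = u" "rk k \<omega> = s" by (auto simp: c_def Tk_def rk_def u_def s_def)
      qed
      define x0 where "x0 = X \<omega>0"
      have x0: "x0 \<in> space N" using measurable_space[OF \<open>X \<in> M \<rightarrow>\<^sub>M N\<close> \<omega>0M] by (simp add: x0_def)
      have Tu: "T \<omega> \<le> u" if "\<omega> \<in> B m" for \<omega> using T_le[of \<omega> k] const[OF that] by simp
      have Q: "(\<lambda>\<omega>. if \<omega> \<in> B m then X \<omega> else x0) \<in> F u \<rightarrow>\<^sub>M N"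
        by (rule measurable_pre_sigma_localise[OF T X B_pre us(1) Tu x0])
      have BF: "B m \<in> sets (F u)" by (rule pre_sigma_localise[OF T B_pre us(1) Tu])
      have ind: "(indicator (B m) :: 'a \<Rightarrow> ennreal) \<in> borel_measurable (F u)"
        using BF by (rule borel_measurable_indicator)
      \<comment> \<open>The event itself is part of the data known at time \<open>u\<close>; it enters \<open>K\<close> as a factor.\<close>
      define Q where "Q \<omega> = ((if \<omega> \<in> B m then X \<omega> else x0), indicator (B m) \<omega> :: ennreal)" for \<omega>
      have Qm: "Q \<in> F u \<rightarrow>\<^sub>M (N \<Otimes>\<^sub>M borel)" unfolding Q_def[abs_def] using Q ind by (rule measurable_Pair)
      define K where "K q z = ennreal (H (fst q) s z) * snd q" for q :: "'b \<times> ennreal" and z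
      have Km: "(\<lambda>(q, z). K q z) \<in> borel_measurable ((N \<Otimes>\<^sub>M borel) \<Otimes>\<^sub>M borel)"
      proof -
        have "(\<lambda>y. (\<lambda>(x, s, z). H x s z) (fst (fst y), s, snd y)) \<in> borel_measurable ((N \<Otimes>\<^sub>M (borel :: ennreal measure)) \<Otimes>\<^sub>M borel)"
          by (rule measurable_compose[OF _ H]) measurable
        then have [measurable]: "(\<lambda>y. H (fst (fst y)) s (snd y)) \<in> borel_measurable ((N \<Otimes>\<^sub>M (borel :: ennreal measure)) \<Otimes>\<^sub>M borel)"
          by simp
        have "(\<lambda>y. ennreal (H (fst (fst y)) s (snd y)) * snd (fst y)) \<in> borel_measurable ((N \<Otimes>\<^sub>M (borel :: ennreal measure)) \<Otimes>\<^sub>M borel)"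
          by measurable
        then show ?thesis by (simp add: K_def split_beta')
      qed
      have "(\<integral>\<^sup>+\<omega>\<in>B m. I k \<omega> \<partial>M) = (\<integral>\<^sup>+\<omega>. K (Q \<omega>) (W (u + s) \<omega> - W u \<omega>) \<partial>M)"
        by (intro nn_integral_cong) (auto simp: I_def K_def Q_def const indicator_def)
      also have "\<dots> = (\<integral>\<^sup>+\<omega>. (\<integral>\<^sup>+z. K (Q \<omega>) (sqrt s *\<^sub>R z) \<partial>std_gaussian) \<partial>M)"
        by (rule independent_increment_integral[OF us Qm Km])
      also have "\<dots> \<le> (\<integral>\<^sup>+\<omega>\<in>B m. v (X \<omega>) \<partial>M)"
      proof (rule nn_integral_mono)
        fix \<omega> assume \<omega>: "\<omega> \<in> space M"
        show "(\<integral>\<^sup>+z. K (Q \<omega>) (sqrt s *\<^sub>R z) \<partial>std_gaussian) \<le> v (X \<omega>) * indicator (B m) \<omega>"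
        proof (cases "\<omega> \<in> B m")
          case True
          then have "s \<le> r \<omega>" using const(2)[OF True] rk_le[of k \<omega>] by simp
          then show ?thesis using True le[OF \<omega> us(2)] by (simp add: K_def Q_def)
        qed (simp add: K_def Q_def)
      qed
      finally show ?thesis .
    qed
    show ?thesis
      by (subst (1 2) split) (auto intro!: suminf_le piece)
  qed
  have "(\<integral>\<^sup>+\<omega>. ennreal (H (X \<omega>) (r \<omega>) (W (T \<omega> + r \<omega>) \<omega> - W (T \<omega>) \<omega>)) \<partial>M) \<le> (\<integral>\<^sup>+\<omega>. liminf (\<lambda>k. I k \<omega>) \<partial>M)"
  proof (rule nn_integral_mono_AE)
    show "AE \<omega> in M. ennreal (H (X \<omega>) (r \<omega>) (W (T \<omega> + r \<omega>) \<omega> - W (T \<omega>) \<omega>)) \<le> liminf (\<lambda>k. I k \<omega>)"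
      using continuous_paths AE_space
    proof eventually_elim
      case (elim \<omega>)
      have t: "(\<lambda>k. Tk k \<omega>) \<longlonglongrightarrow> T \<omega>" "(\<lambda>k. rk k \<omega>) \<longlonglongrightarrow> r \<omega>"
        unfolding Tk_def rk_def by (rule ceiling_grid_tendsto floor_grid_tendsto)+
      have "(\<lambda>k. W (Tk k \<omega> + rk k \<omega>) \<omega> - W (Tk k \<omega>) \<omega>) \<longlonglongrightarrow> W (T \<omega> + r \<omega>) \<omega> - W (T \<omega>) \<omega>"
        using elim(2) T0 r0 Tk0 rk0
        by (intro tendsto_diff continuous_path_tendsto[OF elim(1)] tendsto_add t) (auto intro: add_nonneg_nonneg)
      then have "(\<lambda>k. I k \<omega>) \<longlonglongrightarrow> ennreal (H (X \<omega>) (r \<omega>) (W (T \<omega> + r \<omega>) \<omega> - W (T \<omega>) \<omega>))"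
        unfolding I_def using measurable_space[OF \<open>X \<in> M \<rightarrow>\<^sub>M N\<close> elim(2)] t(2)
        by (intro tendsto_ennrealI H_cont)
      then show ?case using lim_imp_Liminf[OF sequentially_bot] by fastforce
    qed
  qed
  also have "\<dots> \<le> liminf (\<lambda>k. \<integral>\<^sup>+\<omega>. I k \<omega> \<partial>M)" by (rule nn_integral_liminf) simp
  also have "\<dots> \<le> (\<integral>\<^sup>+\<omega>. v (X \<omega>) \<partial>M)"
    using Liminf_mono[of "\<lambda>k. \<integral>\<^sup>+\<omega>. I k \<omega> \<partial>M" "\<lambda>_. \<integral>\<^sup>+\<omega>. v (X \<omega>) \<partial>M" sequentially] discrete
    by (simp add: Liminf_const)
  finally show ?thesis .
qed

end

section \<open>The scheme as a walk with a step rule\<close>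

text \<open>
  The recursion of the scheme with the step length given by a rule \<open>\<rho>\<close> that may depend on the current
  time as well as on the current state. The scheme is the rule \<open>\<rho> (t, y) = \<delta> y\<close>; rules that respect a
  horizon give access to the scheme at a fixed time.
\<close>
primrec em_walk :: "(real ^ 'd \<Rightarrow> real ^ 'd) \<Rightarrow> (real ^ 'd \<Rightarrow> real ^ 'm ^ 'd) \<Rightarrow> (real \<times> (real ^ 'd) \<Rightarrow> real)
    \<Rightarrow> real ^ 'd \<Rightarrow> (real \<Rightarrow> real ^ 'm) \<Rightarrow> nat \<Rightarrow> real \<times> (real ^ 'd)" where
  "em_walk f g \<rho> x0 w 0 = (0, x0)"
| "em_walk f g \<rho> x0 w (Suc n) =
    (let (t, y) = em_walk f g \<rho> x0 w n; s = \<rho> (t, y)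
     in (t + s, y + s *\<^sub>R f y + g y *v (w (t + s) - w t)))"

lemma em_time_0 [simp]: "em_time f g \<delta> x0 w 0 = 0"
  by (simp add: em_time_def)

lemma em_grid_pair: "em_grid f g \<delta> x0 w n = (em_time f g \<delta> x0 w n, em_value f g \<delta> x0 w n)"
  by (simp add: em_time_def em_value_def)

lemma em_time_Suc: "em_time f g \<delta> x0 w (Suc n) = em_time f g \<delta> x0 w n + \<delta> (em_value f g \<delta> x0 w n)"
  by (simp add: em_time_def em_value_def split_beta' Let_def)

lemma em_value_Suc: "em_value f g \<delta> x0 w (Suc n) = em_value f g \<delta> x0 w n
    + \<delta> (em_value f g \<delta> x0 w n) *\<^sub>R f (em_value f g \<delta> x0 w n)
    + g (em_value f g \<delta> x0 w n) *v (w (em_time f g \<delta> x0 w (Suc n)) - w (em_time f g \<delta> x0 w n))"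
  by (simp add: em_time_def em_value_def split_beta' Let_def)

lemma em_walk_eq_grid:
  assumes "\<And>k. k < n \<Longrightarrow> \<rho> (em_grid f g \<delta> x0 w k) = \<delta> (em_value f g \<delta> x0 w k)"
  shows "em_walk f g \<rho> x0 w n = em_grid f g \<delta> x0 w n"
  using assms
proof (induction n)
  case (Suc n)
  then have "em_walk f g \<rho> x0 w n = em_grid f g \<delta> x0 w n" by simp
  moreover have "\<rho> (em_grid f g \<delta> x0 w n) = \<delta> (em_value f g \<delta> x0 w n)" using Suc.prems by simp
  ultimately show ?case
    by (simp add: Let_def em_grid_pair)
       (simp add: Let_def em_time_Suc em_value_Suc)
qed simp

lemma em_walk_stays:
  assumes "\<rho> (em_walk f g \<rho> x0 w n) = 0"
  shows "em_walk f g \<rho> x0 w (n + k) = em_walk f g \<rho> x0 w n"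
proof (induction k)
  case (Suc k)
  then show ?case using assms by (cases "em_walk f g \<rho> x0 w n") simp
qed simp

lemma em_at_grid_interval:
  assumes pos: "\<And>x. 0 < \<delta> x"
    and N: "em_time f g \<delta> x0 w N \<le> t" "t < em_time f g \<delta> x0 w (Suc N)"
  shows "em_floor f g \<delta> x0 w t = em_time f g \<delta> x0 w N"
    and "em_step f g \<delta> x0 w t = em_value f g \<delta> x0 w N"
proof -
  have mono: "strict_mono (em_time f g \<delta> x0 w)"
    by (rule strict_monoI_Suc) (simp add: em_time_Suc pos)
  have set: "{s \<in> range (em_time f g \<delta> x0 w). s \<le> t} = em_time f g \<delta> x0 w ` {..N}"
  proof (intro set_eqI iffI)
    fix s assume "s \<in> {s \<in> range (em_time f g \<delta> x0 w). s \<le> t}"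
    then obtain n where n: "s = em_time f g \<delta> x0 w n" "s \<le> t" by auto
    have "n < Suc N"
    proof (rule ccontr)
      assume "\<not> n < Suc N"
      then have "em_time f g \<delta> x0 w (Suc N) \<le> em_time f g \<delta> x0 w n"
        using strict_mono_less_eq[OF mono] by simp
      with n N show False by simp
    qed
    with n show "s \<in> em_time f g \<delta> x0 w ` {..N}" by auto
  next
    fix s assume "s \<in> em_time f g \<delta> x0 w ` {..N}"
    then obtain n where n: "s = em_time f g \<delta> x0 w n" "n \<le> N" by auto
    then have "s \<le> em_time f g \<delta> x0 w N" using strict_mono_less_eq[OF mono] by simp
    with n N show "s \<in> {s \<in> range (em_time f g \<delta> x0 w). s \<le> t}" by auto
  qed
  show floor: "em_floor f g \<delta> x0 w t = em_time f g \<delta> x0 w N"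
    unfolding em_floor_def set by (rule Max_eqI) (auto simp: strict_mono_less_eq[OF mono])
  have "(THE n. em_time f g \<delta> x0 w n = em_time f g \<delta> x0 w N) = N"
    by (rule the_equality) (auto simp: strict_mono_eq[OF mono])
  then show "em_step f g \<delta> x0 w t = em_value f g \<delta> x0 w N"
    by (simp add: em_step_def floor)
qed

lemma em_grid_interval_exists:
  assumes pos: "\<And>x. 0 < \<delta> x" and t: "0 \<le> t" "t < em_time f g \<delta> x0 w n"
  obtains N where "em_time f g \<delta> x0 w N \<le> t" "t < em_time f g \<delta> x0 w (Suc N)"
proof -
  define m where "m = (LEAST n. t < em_time f g \<delta> x0 w n)"
  have m: "t < em_time f g \<delta> x0 w m" unfolding m_def using t(2) by (rule LeastI)
  with t have "m \<noteq> 0" by (cases m) auto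
  then obtain N where N: "m = Suc N" by (cases m) auto
  have "\<not> t < em_time f g \<delta> x0 w N" using not_less_Least[of N "\<lambda>n. t < em_time f g \<delta> x0 w n"] N by (simp add: m_def)
  with m N show thesis by (intro that[of N]) auto
qed

section \<open>The Lyapunov function along a walk\<close>

locale em_brownian = brownian_motion M F W + adaptive_em f g \<delta> p K6 K7 \<delta>max \<gamma>
  for M :: "'a measure" and F :: "real \<Rightarrow> 'a measure" and W :: "real \<Rightarrow> 'a \<Rightarrow> real ^ 'm"
    and f :: "real ^ 'd \<Rightarrow> real ^ 'd" and g :: "real ^ 'd \<Rightarrow> real ^ 'm ^ 'd"
    and \<delta> :: "real ^ 'd \<Rightarrow> real" and p K6 K7 \<delta>max \<gamma> :: real +
  fixes x0 :: "real ^ 'd"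
begin

lemma coefficients_measurable [measurable]: "f \<in> borel \<rightarrow>\<^sub>M borel" "g \<in> borel \<rightarrow>\<^sub>M borel" "\<delta> \<in> borel \<rightarrow>\<^sub>M borel"
  by (intro borel_measurable_continuous_onI coefficients_continuous step_continuous)+

lemma V_continuous: "continuous_on UNIV V"
  unfolding V_def[abs_def] by (intro continuous_intros) (auto simp: add_nonneg_eq_0_iff)

lemma V_measurable [measurable]: "V \<in> borel \<rightarrow>\<^sub>M borel"
  by (intro borel_measurable_continuous_onI V_continuous)

abbreviation walk :: "(real \<times> (real ^ 'd) \<Rightarrow> real) \<Rightarrow> nat \<Rightarrow> 'a \<Rightarrow> real \<times> (real ^ 'd)" where
  "walk \<rho> n \<omega> \<equiv> em_walk f g \<rho> x0 (\<lambda>t. W t \<omega>) n"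

text \<open>
  Nothing is asked beyond the horizon, since a walk that starts at time \<open>0\<close> never gets there.
\<close>
definition admissible :: "real \<Rightarrow> (real \<times> (real ^ 'd) \<Rightarrow> real) \<Rightarrow> bool" where
  "admissible Tm \<rho> \<longleftrightarrow> \<rho> \<in> borel_measurable (borel \<Otimes>\<^sub>M borel) \<and>
     (\<forall>t y. t \<le> Tm \<longrightarrow> 0 \<le> \<rho> (t, y) \<and> \<rho> (t, y) \<le> \<delta> y \<and> t + \<rho> (t, y) \<le> Tm)"

lemma walk_time_bounds:
  assumes "admissible Tm \<rho>" "0 \<le> Tm"
  shows "0 \<le> fst (walk \<rho> n \<omega>) \<and> fst (walk \<rho> n \<omega>) \<le> Tm"
proof (induction n)
  case (Suc n)
  then show ?case using assms(1)
    by (cases "walk \<rho> n \<omega>") (auto simp: admissible_def Let_def)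
qed (use assms in simp)

text \<open>
  The next time of the walk is at least the current one and is already known at the current one,
  hence it is a stopping time; the next state is then built from data known at either time.
\<close>
lemma walk_stopping_time:
  assumes \<rho>: "admissible Tm \<rho>" and Tm: "0 \<le> Tm"
  shows "stopping_time FF (\<lambda>\<omega>. fst (walk \<rho> n \<omega>)) \<and>
    walk \<rho> n \<in> pre_sigma (\<lambda>\<omega>. fst (walk \<rho> n \<omega>)) \<rightarrow>\<^sub>M (borel \<Otimes>\<^sub>M borel)"
proof (induction n)
  case 0
  show ?case by (simp add: stopping_time_const)
next
  case (Suc n)
  define S where "S \<omega> = fst (walk \<rho> n \<omega>)" for \<omega>
  define S' where "S' \<omega> = fst (walk \<rho> (Suc n) \<omega>)" for \<omega>
  have S: "stopping_time FF S" and walk [measurable]: "walk \<rho> n \<in> pre_sigma S \<rightarrow>\<^sub>M (borel \<Otimes>\<^sub>M borel)"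
    using Suc unfolding S_def by auto
  have \<rho>m [measurable]: "\<rho> \<in> borel_measurable (borel \<Otimes>\<^sub>M borel)" using \<rho> by (simp add: admissible_def)
  have S'_eq: "S' \<omega> = S \<omega> + \<rho> (walk \<rho> n \<omega>)" for \<omega>
    by (simp add: S'_def S_def Let_def split_beta')
  have S0: "0 \<le> S \<omega>" "0 \<le> S' \<omega>" for \<omega>
    unfolding S_def S'_def using walk_time_bounds[OF \<rho> Tm] by blast+
  have S_le: "S \<omega> \<le> S' \<omega>" for \<omega>
  proof -
    have "S \<omega> \<le> Tm" unfolding S_def using walk_time_bounds[OF \<rho> Tm] by blast
    then show ?thesis using \<rho> unfolding S'_eq admissible_def S_def
      by (cases "walk \<rho> n \<omega>") auto
  qed
  have S'm: "S' \<in> borel_measurable (pre_sigma S)" unfolding S'_eq[abs_def]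
    using measurable_stopping_time_pre_sigma[OF S] by measurable
  have S': "stopping_time FF S'"
  proof (rule stopping_timeI)
    fix t
    have "{\<omega> \<in> space (pre_sigma S). S' \<omega> \<le> t} \<in> sets (pre_sigma S)"
      using S'm by (simp add: borel_measurable_iff_le)
    from sets_pre_sigmaD[OF S this, of t]
    have "{\<omega> \<in> space (FF t). S' \<omega> \<le> t \<and> S \<omega> \<le> t} \<in> sets (FF t)"
      by (simp add: space_pre_sigma space_F_eq conj_ac)
    moreover have "{\<omega> \<in> space (FF t). S' \<omega> \<le> t \<and> S \<omega> \<le> t} = {\<omega> \<in> space (FF t). S' \<omega> \<le> t}"
      using S_le order_trans by blast
    ultimately show "Measurable.pred (FF t) (\<lambda>\<omega>. S' \<omega> \<le> t)" by (simp add: pred_def)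
  qed
  have mono: "sets (pre_sigma S) \<subseteq> sets (pre_sigma S')" by (rule mono_pre_sigma[OF S S' S_le])
  have sp: "space (pre_sigma S) = space (pre_sigma S')" by (simp add: space_pre_sigma)
  note up = measurable_mono[OF order_refl refl mono sp, THEN subsetD]
  have [measurable]: "walk \<rho> n \<in> pre_sigma S' \<rightarrow>\<^sub>M (borel \<Otimes>\<^sub>M borel)" by (rule up[OF walk])
  have [measurable]: "(\<lambda>\<omega>. W (S \<omega>) \<omega>) \<in> pre_sigma S' \<rightarrow>\<^sub>M borel"
    by (rule up[OF measurable_pre_sigma_W[OF S S0(1)]])
  have [measurable]: "(\<lambda>\<omega>. W (S' \<omega>) \<omega>) \<in> pre_sigma S' \<rightarrow>\<^sub>M borel"
    by (rule measurable_pre_sigma_W[OF S' S0(2)])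
  have eq: "walk \<rho> (Suc n) = (\<lambda>\<omega>. (fst (walk \<rho> n \<omega>) + \<rho> (walk \<rho> n \<omega>),
      snd (walk \<rho> n \<omega>) + \<rho> (walk \<rho> n \<omega>) *\<^sub>R f (snd (walk \<rho> n \<omega>))
        + g (snd (walk \<rho> n \<omega>)) *v (W (S' \<omega>) \<omega> - W (S \<omega>) \<omega>)))"
    by (rule ext) (simp add: Let_def split_beta' S'_eq S_def)
  have "walk \<rho> (Suc n) \<in> pre_sigma S' \<rightarrow>\<^sub>M (borel \<Otimes>\<^sub>M borel)"
    unfolding eq by measurable
  with S' show ?case unfolding S'_def by simp
qed

lemma walk_measurable:
  assumes "admissible Tm \<rho>" "0 \<le> Tm"
  shows "walk \<rho> n \<in> M \<rightarrow>\<^sub>M (borel \<Otimes>\<^sub>M borel)"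
proof (rule measurable_pre_sigma_imp_M)
  show "stopping_time FF (\<lambda>\<omega>. fst (walk \<rho> n \<omega>))"
    "walk \<rho> n \<in> pre_sigma (\<lambda>\<omega>. fst (walk \<rho> n \<omega>)) \<rightarrow>\<^sub>M (borel \<Otimes>\<^sub>M borel)"
    using walk_stopping_time[OF assms, of n] by blast+
  show "0 \<le> fst (walk \<rho> n \<omega>)" for \<omega>
    by (rule walk_time_bounds[OF assms, THEN conjunct1])
qed

text \<open>
  The term \<open>C (exp (rate * Tm) - exp (rate * t))\<close> is the budget for the inhomogeneous part of the
  contraction that has not been spent by time \<open>t\<close>. It makes \<open>U\<close> a nonnegative supermartingale along
  walks that respect the horizon \<open>Tm\<close>.
\<close>
definition U :: "real \<Rightarrow> real \<Rightarrow> real \<times> (real ^ 'd) \<Rightarrow> real" where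
  "U C Tm = (\<lambda>(t, y). exp (rate * t) * V y + C * (exp (rate * Tm) - exp (rate * t)))"

lemma U_measurable [measurable]: "U C Tm \<in> borel_measurable (borel \<Otimes>\<^sub>M borel)"
  unfolding U_def by measurable

definition contraction_const :: "real \<Rightarrow> bool" where
  "contraction_const C \<longleftrightarrow> 0 \<le> C \<and> (\<forall>y s. 0 \<le> s \<longrightarrow> s \<le> \<delta> y \<longrightarrow>
    (\<integral>\<^sup>+z. ennreal (V (y + s *\<^sub>R f y + g y *v (sqrt s *\<^sub>R z))) \<partial>std_gaussian)
      \<le> ennreal (exp (- rate * s) * V y + C * (1 - exp (- rate * s))))"

lemma contraction_const_exists: "\<exists>C. contraction_const C"
  using one_step_contraction[OF gaussian_noise] unfolding contraction_const_def by metis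

lemma U_one_step:
  assumes C: "contraction_const C" and s: "0 \<le> s" "s \<le> \<delta> y" "t + s \<le> Tm"
  shows "(\<integral>\<^sup>+z. ennreal (U C Tm (t + s, y + s *\<^sub>R f y + g y *v (sqrt s *\<^sub>R z))) \<partial>std_gaussian)
    \<le> ennreal (U C Tm (t, y))"
proof -
  interpret noise: isotropic_noise "std_gaussian :: (real ^ 'm) measure" by (rule gaussian_noise)
  have C0: "0 \<le> C" using C by (simp add: contraction_const_def)
  define d where "d = C * (exp (rate * Tm) - exp (rate * (t + s)))"
  have d: "0 \<le> d" unfolding d_def using C0 s rate_pos by (intro mult_nonneg_nonneg) auto
  have "(\<integral>\<^sup>+z. ennreal (U C Tm (t + s, y + s *\<^sub>R f y + g y *v (sqrt s *\<^sub>R z))) \<partial>std_gaussian)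
      = (\<integral>\<^sup>+z. ennreal (exp (rate * (t + s))) * ennreal (V (y + s *\<^sub>R f y + g y *v (sqrt s *\<^sub>R z))) + ennreal d \<partial>std_gaussian)"
    using d by (intro nn_integral_cong) (simp add: U_def d_def ennreal_mult' ennreal_plus)
  also have "\<dots> = ennreal (exp (rate * (t + s))) * (\<integral>\<^sup>+z. ennreal (V (y + s *\<^sub>R f y + g y *v (sqrt s *\<^sub>R z))) \<partial>std_gaussian) + ennreal d"
    using noise.emeasure_space_1 by (subst nn_integral_add) (auto simp: nn_integral_cmult)
  also have "\<dots> \<le> ennreal (exp (rate * (t + s))) * ennreal (exp (- rate * s) * V y + C * (1 - exp (- rate * s))) + ennreal d"
    using C s unfolding contraction_const_def by (intro add_right_mono mult_left_mono) auto
  also have "\<dots> = ennreal (exp (rate * (t + s)) * (exp (- rate * s) * V y + C * (1 - exp (- rate * s))) + d)"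
  proof -
    have "0 \<le> exp (- rate * s) * V y + C * (1 - exp (- rate * s))"
      using C0 s rate_pos by (intro add_nonneg_nonneg mult_nonneg_nonneg) auto
    then show ?thesis using d by (simp add: ennreal_mult' ennreal_plus)
  qed
  also have "exp (rate * (t + s)) * (exp (- rate * s) * V y + C * (1 - exp (- rate * s))) + d = U C Tm (t, y)"
  proof -
    have e: "exp (rate * (t + s)) * exp (- rate * s) = exp (rate * t)"
      by (simp add: algebra_simps flip: exp_add)
    have "exp (rate * (t + s)) * (exp (- rate * s) * V y + C * (1 - exp (- rate * s)))
        = (exp (rate * (t + s)) * exp (- rate * s)) * V y + C * (exp (rate * (t + s)) - exp (rate * (t + s)) * exp (- rate * s))"
      by (simp add: algebra_simps)
    then show ?thesis unfolding e by (simp add: U_def d_def algebra_simps)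
  qed
  finally show ?thesis .
qed

lemma U_supermartingale:
  assumes C: "contraction_const C" and \<rho>: "admissible Tm \<rho>" and Tm: "0 \<le> Tm"
  shows "(\<integral>\<^sup>+\<omega>. ennreal (U C Tm (walk \<rho> n \<omega>)) \<partial>M) \<le> ennreal (U C Tm (0, x0))"
proof (induction n)
  case 0
  show ?case using emeasure_space_1 by simp
next
  case (Suc n)
  define S where "S \<omega> = fst (walk \<rho> n \<omega>)" for \<omega>
  have S: "stopping_time FF S" and X [measurable]: "walk \<rho> n \<in> pre_sigma S \<rightarrow>\<^sub>M (borel \<Otimes>\<^sub>M borel)"
    using walk_stopping_time[OF \<rho> Tm, of n] unfolding S_def by auto
  have [measurable]: "\<rho> \<in> borel_measurable (borel \<Otimes>\<^sub>M borel)" using \<rho> by (simp add: admissible_def)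
  have S_bounds: "0 \<le> S \<omega>" "S \<omega> \<le> Tm" for \<omega>
    unfolding S_def using walk_time_bounds[OF \<rho> Tm] by blast+
  have \<rho>_bounds: "0 \<le> \<rho> (walk \<rho> n \<omega>)" "\<rho> (walk \<rho> n \<omega>) \<le> \<delta> (snd (walk \<rho> n \<omega>))"
      "fst (walk \<rho> n \<omega>) + \<rho> (walk \<rho> n \<omega>) \<le> Tm" for \<omega>
    using \<rho> S_bounds(2)[of \<omega>] unfolding admissible_def S_def by (cases "walk \<rho> n \<omega>"; auto)+
  define H where "H x s z = U C Tm (fst x + s, snd x + s *\<^sub>R f (snd x) + g (snd x) *v z)"
    for x :: "real \<times> (real ^ 'd)" and s :: real and z :: "real ^ 'm"
  have "(\<integral>\<^sup>+\<omega>. ennreal (U C Tm (walk \<rho> (Suc n) \<omega>)) \<partial>M)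
      = (\<integral>\<^sup>+\<omega>. ennreal (H (walk \<rho> n \<omega>) (\<rho> (walk \<rho> n \<omega>)) (W (S \<omega> + \<rho> (walk \<rho> n \<omega>)) \<omega> - W (S \<omega>) \<omega>)) \<partial>M)"
    by (intro nn_integral_cong) (simp add: H_def S_def Let_def split_beta')
  also have "\<dots> \<le> (\<integral>\<^sup>+\<omega>. ennreal (U C Tm (walk \<rho> n \<omega>)) \<partial>M)"
  proof (rule random_time_step_le[OF S S_bounds(1) X, where H = H and r = "\<lambda>\<omega>. \<rho> (walk \<rho> n \<omega>)"
        and v = "\<lambda>x. ennreal (U C Tm x)"])
    show "(\<lambda>\<omega>. \<rho> (walk \<rho> n \<omega>)) \<in> borel_measurable (pre_sigma S)" by measurable
    show "0 \<le> \<rho> (walk \<rho> n \<omega>)" for \<omega> by (rule \<rho>_bounds)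
    show "(\<lambda>(x, s, z). H x s z) \<in> borel_measurable ((borel \<Otimes>\<^sub>M borel) \<Otimes>\<^sub>M borel \<Otimes>\<^sub>M borel)"
      unfolding H_def by measurable
    show "(\<lambda>x. ennreal (U C Tm x)) \<in> borel_measurable (borel \<Otimes>\<^sub>M borel)" by measurable
    show "(\<lambda>k. H x (sk k) (zk k)) \<longlonglongrightarrow> H x s z" if "sk \<longlonglongrightarrow> s" "zk \<longlonglongrightarrow> z" for x sk s zk z
    proof -
      have "(\<lambda>k. V (snd x + sk k *\<^sub>R f (snd x) + g (snd x) *v zk k)) \<longlonglongrightarrow> V (snd x + s *\<^sub>R f (snd x) + g (snd x) *v z)"
        by (intro continuous_on_tendsto_compose[OF V_continuous] tendsto_intros that tendsto_matrix_vector_mult) auto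
      then show ?thesis unfolding H_def U_def prod.case
        by (intro tendsto_intros that)
    qed
    show "(\<integral>\<^sup>+z. ennreal (H (walk \<rho> n \<omega>) s (sqrt s *\<^sub>R z)) \<partial>std_gaussian) \<le> ennreal (U C Tm (walk \<rho> n \<omega>))"
      if "0 \<le> s" "s \<le> \<rho> (walk \<rho> n \<omega>)" for \<omega> s
      using U_one_step[OF C that(1), of "snd (walk \<rho> n \<omega>)" "fst (walk \<rho> n \<omega>)" Tm] that \<rho>_bounds[of \<omega>]
      by (simp add: H_def)
  qed
  also note Suc
  finally show ?case .
qed

text \<open>
  This form serves both purposes: where the walk becomes stationary the limit inferior is the value at
  the final state, and where the scheme explodes it is infinite.
\<close>
lemma U_liminf:
  assumes C: "contraction_const C" and \<rho>: "admissible Tm \<rho>" and Tm: "0 \<le> Tm"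
  shows "(\<integral>\<^sup>+\<omega>. liminf (\<lambda>n. ennreal (U C Tm (walk \<rho> n \<omega>))) \<partial>M) \<le> ennreal (U C Tm (0, x0))"
proof -
  note [measurable] = walk_measurable[OF \<rho> Tm]
  have "(\<integral>\<^sup>+\<omega>. liminf (\<lambda>n. ennreal (U C Tm (walk \<rho> n \<omega>))) \<partial>M)
      \<le> liminf (\<lambda>n. \<integral>\<^sup>+\<omega>. ennreal (U C Tm (walk \<rho> n \<omega>)) \<partial>M)"
    by (rule nn_integral_liminf) measurable
  also have "\<dots> \<le> ennreal (U C Tm (0, x0))"
    using Liminf_mono[of "\<lambda>n. \<integral>\<^sup>+\<omega>. ennreal (U C Tm (walk \<rho> n \<omega>)) \<partial>M" "\<lambda>_. ennreal (U C Tm (0, x0))" sequentially]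
      U_supermartingale[OF C \<rho> Tm] by (simp add: Liminf_const)
  finally show ?thesis .
qed

section \<open>Non-explosion and moment bounds\<close>

text \<open>
  The first rule shortens the step that would pass the horizon, so that the walk ends at the
  interpolated value; the second one suppresses this step, so that the walk ends at the last grid
  point.
\<close>
definition stop_rule :: "real \<Rightarrow> real \<times> (real ^ 'd) \<Rightarrow> real" where
  "stop_rule Tm = (\<lambda>(t, y). min (\<delta> y) (Tm - t))"

definition freeze_rule :: "real \<Rightarrow> real \<times> (real ^ 'd) \<Rightarrow> real" where
  "freeze_rule Tm = (\<lambda>(t, y). if t + \<delta> y \<le> Tm then \<delta> y else 0)"

lemma admissible_rules: "admissible Tm (stop_rule Tm)" "admissible Tm (freeze_rule Tm)"
  unfolding admissible_def stop_rule_def freeze_rule_def using step_pos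
  by (auto simp: less_imp_le min_def)

abbreviation grid_time :: "'a \<Rightarrow> nat \<Rightarrow> real" where "grid_time \<omega> n \<equiv> em_time f g \<delta> x0 (\<lambda>t. W t \<omega>) n"
abbreviation grid_value :: "'a \<Rightarrow> nat \<Rightarrow> real ^ 'd" where "grid_value \<omega> n \<equiv> em_value f g \<delta> x0 (\<lambda>t. W t \<omega>) n"

lemma grid_time_mono: "strict_mono (grid_time \<omega>)"
  by (rule strict_monoI_Suc) (simp add: em_time_Suc step_pos)

lemma freeze_walk_limit:
  assumes N: "grid_time \<omega> N \<le> Tm" "Tm < grid_time \<omega> (Suc N)" and n: "N \<le> n"
  shows "walk (freeze_rule Tm) n \<omega> = (grid_time \<omega> N, grid_value \<omega> N)"
proof -
  have "walk (freeze_rule Tm) N \<omega> = em_grid f g \<delta> x0 (\<lambda>t. W t \<omega>) N"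
  proof (rule em_walk_eq_grid)
    fix k assume "k < N"
    then have "grid_time \<omega> (Suc k) \<le> grid_time \<omega> N" using strict_mono_less_eq[OF grid_time_mono, of \<omega> "Suc k" N] by simp
    then show "freeze_rule Tm (em_grid f g \<delta> x0 (\<lambda>t. W t \<omega>) k) = \<delta> (grid_value \<omega> k)"
      using N by (simp add: freeze_rule_def em_grid_pair em_time_Suc)
  qed
  then have eq: "walk (freeze_rule Tm) N \<omega> = (grid_time \<omega> N, grid_value \<omega> N)" by (simp add: em_grid_pair)
  moreover have "freeze_rule Tm (walk (freeze_rule Tm) N \<omega>) = 0"
    unfolding eq using N by (simp add: freeze_rule_def em_time_Suc)
  ultimately show ?thesis using em_walk_stays[of "freeze_rule Tm" f g x0 "\<lambda>t. W t \<omega>" N "n - N"] n by simp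
qed

lemma stop_walk_limit:
  assumes N: "grid_time \<omega> N \<le> Tm" "Tm < grid_time \<omega> (Suc N)" and n: "Suc N \<le> n"
  shows "walk (stop_rule Tm) n \<omega> = (Tm, em_interp f g \<delta> x0 (\<lambda>t. W t \<omega>) Tm)"
proof -
  have "walk (stop_rule Tm) N \<omega> = em_grid f g \<delta> x0 (\<lambda>t. W t \<omega>) N"
  proof (rule em_walk_eq_grid)
    fix k assume "k < N"
    then have "grid_time \<omega> (Suc k) \<le> grid_time \<omega> N" using strict_mono_less_eq[OF grid_time_mono, of \<omega> "Suc k" N] by simp
    then show "stop_rule Tm (em_grid f g \<delta> x0 (\<lambda>t. W t \<omega>) k) = \<delta> (grid_value \<omega> k)"
      using N by (simp add: stop_rule_def em_grid_pair em_time_Suc)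
  qed
  then have eq: "walk (stop_rule Tm) N \<omega> = (grid_time \<omega> N, grid_value \<omega> N)" by (simp add: em_grid_pair)
  have \<rho>: "stop_rule Tm (grid_time \<omega> N, grid_value \<omega> N) = Tm - grid_time \<omega> N"
    using N by (simp add: stop_rule_def em_time_Suc)
  have eq2: "walk (stop_rule Tm) (Suc N) \<omega> = (Tm, em_interp f g \<delta> x0 (\<lambda>t. W t \<omega>) Tm)"
    by (simp add: eq \<rho> Let_def em_interp_def em_at_grid_interval[OF step_pos N])
  have "stop_rule Tm (walk (stop_rule Tm) (Suc N) \<omega>) = 0"
    unfolding eq2 using step_pos by (simp add: stop_rule_def less_imp_le)
  from em_walk_stays[where \<rho> = "stop_rule Tm", OF this, of "n - Suc N"] n eq2 show ?thesis by simp
qed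

lemma V_ge_norm: "norm y \<le> V y"
proof -
  have "2 * norm y \<le> 1 + (norm y)\<^sup>2"
    using zero_le_power2[of "norm y - 1"] by (simp add: power2_eq_square algebra_simps)
  then have "norm y \<le> 1 + (norm y)\<^sup>2" using norm_ge_zero[of y] by linarith
  also have "\<dots> = (1 + (norm y)\<^sup>2) powr 1" by (simp add: add_nonneg_nonneg)
  also have "\<dots> \<le> V y" unfolding V_def using p_ge by (intro powr_mono) auto
  finally show ?thesis .
qed

text \<open>
  If the grid times converge, the step lengths tend to \<open>0\<close>; but on every ball \<open>\<delta>\<close> has a positive minimum,
  so the values leave every ball.
\<close>
lemma value_diverges_on_explosion:
  assumes "\<And>n. grid_time \<omega> n \<le> Tm"
  shows "filterlim (\<lambda>n. norm (grid_value \<omega> n)) at_top sequentially"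
  unfolding filterlim_at_top_gt[where c = 0]
proof (intro allI impI)
  fix K :: real assume K: "0 < K"
  have inc: "incseq (grid_time \<omega>)" using grid_time_mono strict_mono_mono by (auto simp: incseq_def mono_def)
  have "\<forall>n. grid_time \<omega> n \<le> Tm" using assms by blast
  from incseq_convergent[OF inc this] obtain l where l: "grid_time \<omega> \<longlonglongrightarrow> l" by blast
  have "(\<lambda>n. grid_time \<omega> (Suc n) - grid_time \<omega> n) \<longlonglongrightarrow> l - l" by (intro tendsto_diff LIMSEQ_Suc l)
  then have lim: "(\<lambda>n. \<delta> (grid_value \<omega> n)) \<longlonglongrightarrow> 0" by (simp add: em_time_Suc)
  have "\<exists>x\<in>cball 0 K. \<forall>y\<in>cball 0 K. \<delta> x \<le> \<delta> y"
    using K by (intro continuous_attains_inf continuous_on_subset[OF step_continuous]) auto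
  then obtain x where "\<forall>y\<in>cball 0 K. \<delta> x \<le> \<delta> y" by blast
  then have x: "\<delta> x \<le> \<delta> y" if "norm y \<le> K" for y using that by simp
  have "\<forall>\<^sub>F n in sequentially. \<delta> (grid_value \<omega> n) < \<delta> x" by (rule order_tendstoD(2)[OF lim step_pos])
  then show "\<forall>\<^sub>F n in sequentially. K \<le> norm (grid_value \<omega> n)"
  proof eventually_elim
    case (elim n)
    then show ?case using x[of "grid_value \<omega> n"] by linarith
  qed
qed

text \<open>
  On the event of explosion before \<open>Tm\<close> the walk of \<open>freeze_rule\<close> is the whole scheme and \<open>U\<close> tends to
  infinity along it, while the limit inferior of \<open>U\<close> is almost surely finite.
\<close>
lemma no_explosion_before:
  assumes Tm: "0 \<le> Tm"
  shows "AE \<omega> in M. \<exists>n. Tm < grid_time \<omega> n"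
proof -
  obtain C where C: "contraction_const C" using contraction_const_exists by blast
  then have C0: "0 \<le> C" by (simp add: contraction_const_def)
  note \<rho> = admissible_rules(2)[of Tm]
  note [measurable] = walk_measurable[OF \<rho> Tm]
  have "(\<integral>\<^sup>+\<omega>. liminf (\<lambda>n. ennreal (U C Tm (walk (freeze_rule Tm) n \<omega>))) \<partial>M) \<noteq> \<infinity>"
    using U_liminf[OF C \<rho> Tm] by (auto simp: top_unique)
  then have "AE \<omega> in M. liminf (\<lambda>n. ennreal (U C Tm (walk (freeze_rule Tm) n \<omega>))) \<noteq> \<infinity>"
    by (intro nn_integral_PInf_AE) measurable
  then show ?thesis
  proof eventually_elim
    case (elim \<omega>)
    show ?case
    proof (rule ccontr)
      assume "\<not> (\<exists>n. Tm < grid_time \<omega> n)"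
      then have le: "grid_time \<omega> n \<le> Tm" for n by (simp add: not_less)
      have eq: "walk (freeze_rule Tm) n \<omega> = (grid_time \<omega> n, grid_value \<omega> n)" for n
        unfolding em_grid_pair[symmetric]
      proof (rule em_walk_eq_grid)
        fix k
        show "freeze_rule Tm (em_grid f g \<delta> x0 (\<lambda>t. W t \<omega>) k) = \<delta> (grid_value \<omega> k)"
          using le[of "Suc k"] by (simp add: freeze_rule_def em_grid_pair em_time_Suc)
      qed
      have time0: "0 \<le> grid_time \<omega> n" for n
        using strict_mono_less_eq[OF grid_time_mono, of \<omega> 0 n] by simp
      have ge: "norm (grid_value \<omega> n) \<le> U C Tm (walk (freeze_rule Tm) n \<omega>)" for n
      proof -
        have "norm (grid_value \<omega> n) \<le> 1 * V (grid_value \<omega> n)" using V_ge_norm by simp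
        also have "\<dots> \<le> exp (rate * grid_time \<omega> n) * V (grid_value \<omega> n)"
          using time0 rate_pos by (intro mult_right_mono) auto
        also have "\<dots> \<le> U C Tm (grid_time \<omega> n, grid_value \<omega> n)"
          unfolding U_def using C0 le[of n] rate_pos by simp
        finally show ?thesis by (simp add: eq)
      qed
      have "(\<lambda>n. ennreal (U C Tm (walk (freeze_rule Tm) n \<omega>))) \<longlonglongrightarrow> top"
        unfolding tendsto_top_iff_ennreal
      proof (intro allI impI)
        fix l :: real assume l: "0 \<le> l"
        have "\<forall>\<^sub>F n in sequentially. l + 1 \<le> norm (grid_value \<omega> n)"
          using value_diverges_on_explosion[OF le] by (auto simp: filterlim_at_top)
        then show "\<forall>\<^sub>F n in sequentially. ennreal l < ennreal (U C Tm (walk (freeze_rule Tm) n \<omega>))"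
        proof eventually_elim
          case (elim n)
          then have "l < U C Tm (walk (freeze_rule Tm) n \<omega>)" using ge[of n] by linarith
          then show ?case using l by (intro ennreal_lessI) auto
        qed
      qed
      then have "liminf (\<lambda>n. ennreal (U C Tm (walk (freeze_rule Tm) n \<omega>))) = top"
        by (rule lim_imp_Liminf[OF sequentially_bot])
      with elim show False by simp
    qed
  qed
qed

lemma no_explosion: "AE \<omega> in M. \<forall>t\<ge>0. \<exists>n. t < grid_time \<omega> n"
proof -
  have "AE \<omega> in M. \<forall>k :: nat. \<exists>n. real k < grid_time \<omega> n"
    unfolding AE_all_countable by (intro allI no_explosion_before) simp
  then show ?thesis
  proof eventually_elim
    case (elim \<omega>)
    show ?case
    proof (intro allI impI)
      fix t :: real
      obtain k :: nat where "t \<le> real k" using real_arch_simple by blast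
      with elim show "\<exists>n. t < grid_time \<omega> n" by (meson order_le_less_trans)
    qed
  qed
qed

text \<open>
  The final time \<open>s\<close> of the walk is within \<open>\<delta>max\<close> of the horizon. Hence \<open>U\<close> at the final state is at
  least \<open>c * |Y| powr p\<close> with \<open>c = exp (rate * (Tm - \<delta>max))\<close>, whereas its initial value is at most
  \<open>exp (rate * Tm) * (V x0 + C)\<close>; the quotient of the two is independent of the horizon.
\<close>
lemma walk_limit_moment:
  assumes C: "contraction_const C" and \<rho>: "admissible Tm \<rho>" and Tm: "0 \<le> Tm"
    and lim: "AE \<omega> in M. \<exists>N. \<exists>s. Tm - \<delta>max \<le> s \<and> (\<forall>n\<ge>N. walk \<rho> n \<omega> = (s, Y \<omega>))"
  shows "integrable M (\<lambda>\<omega>. norm (Y \<omega>) powr p)"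
    "(\<integral>\<omega>. norm (Y \<omega>) powr p \<partial>M) \<le> exp (rate * \<delta>max) * (V x0 + C)"
proof -
  have C0: "0 \<le> C" using C by (simp add: contraction_const_def)
  note wm [measurable] = walk_measurable[OF \<rho> Tm]
  define y where "y n \<omega> = snd (walk \<rho> n \<omega>)" for n \<omega>
  have [measurable]: "y n \<in> M \<rightarrow>\<^sub>M borel" for n unfolding y_def[abs_def] by measurable
  have Ym: "(\<lambda>\<omega>. norm (Y \<omega>) powr p) \<in> borel_measurable M"
  proof (rule measurable_AE_cong[OF _ refl])
    show "(\<lambda>\<omega>. lim (\<lambda>n. norm (y n \<omega>) powr p)) \<in> borel_measurable M" by measurable
    show "AE \<omega> in M. lim (\<lambda>n. norm (y n \<omega>) powr p) = norm (Y \<omega>) powr p"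
      using lim
    proof eventually_elim
      case (elim \<omega>)
      then obtain N s where N: "\<And>n. N \<le> n \<Longrightarrow> walk \<rho> n \<omega> = (s, Y \<omega>)" by blast
      have "\<forall>\<^sub>F n in sequentially. norm (y n \<omega>) powr p = norm (Y \<omega>) powr p"
        using eventually_ge_at_top[of N] by eventually_elim (simp add: y_def N)
      then show ?case by (intro limI tendsto_eventually)
    qed
  qed auto
  define c where "c = exp (rate * (Tm - \<delta>max))"
  have c: "0 < c" by (simp add: c_def)
  have "ennreal c * (\<integral>\<^sup>+\<omega>. ennreal (norm (Y \<omega>) powr p) \<partial>M) = (\<integral>\<^sup>+\<omega>. ennreal c * ennreal (norm (Y \<omega>) powr p) \<partial>M)"
    using Ym by (subst nn_integral_cmult) auto
  also have "\<dots> \<le> (\<integral>\<^sup>+\<omega>. liminf (\<lambda>n. ennreal (U C Tm (walk \<rho> n \<omega>))) \<partial>M)"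
  proof (rule nn_integral_mono_AE)
    show "AE \<omega> in M. ennreal c * ennreal (norm (Y \<omega>) powr p) \<le> liminf (\<lambda>n. ennreal (U C Tm (walk \<rho> n \<omega>)))"
      using lim
    proof eventually_elim
      case (elim \<omega>)
      then obtain N s where s: "Tm - \<delta>max \<le> s" and N: "\<And>n. N \<le> n \<Longrightarrow> walk \<rho> n \<omega> = (s, Y \<omega>)" by blast
      have sTm: "s \<le> Tm" using walk_time_bounds[OF \<rho> Tm, of \<omega> N] N[of N] by simp
      have "\<forall>\<^sub>F n in sequentially. ennreal (U C Tm (walk \<rho> n \<omega>)) = ennreal (U C Tm (s, Y \<omega>))"
        using eventually_ge_at_top[of N] by eventually_elim (simp add: N)
      then have "liminf (\<lambda>n. ennreal (U C Tm (walk \<rho> n \<omega>))) = ennreal (U C Tm (s, Y \<omega>))"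
        by (intro lim_imp_Liminf tendsto_eventually) auto
      moreover have "c * norm (Y \<omega>) powr p \<le> U C Tm (s, Y \<omega>)"
      proof -
        have "c * norm (Y \<omega>) powr p \<le> exp (rate * s) * V (Y \<omega>)"
          unfolding c_def using s rate_pos by (intro mult_mono norm_powr_le_V) auto
        also have "\<dots> \<le> U C Tm (s, Y \<omega>)" unfolding U_def using C0 sTm rate_pos by simp
        finally show ?thesis .
      qed
      ultimately show ?case using c by (simp add: ennreal_leI flip: ennreal_mult'')
    qed
  qed
  also have "\<dots> \<le> ennreal (U C Tm (0, x0))" by (rule U_liminf[OF C \<rho> Tm])
  also have "U C Tm (0, x0) \<le> exp (rate * Tm) * (V x0 + C)"
  proof -
    have "1 * V x0 \<le> exp (rate * Tm) * V x0" using Tm rate_pos by (intro mult_right_mono) auto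
    moreover have "C * (exp (rate * Tm) - 1) \<le> C * exp (rate * Tm)" using C0 by (intro mult_left_mono) auto
    ultimately show ?thesis by (simp add: U_def algebra_simps)
  qed
  also have "exp (rate * Tm) * (V x0 + C) = c * (exp (rate * \<delta>max) * (V x0 + C))"
    unfolding c_def by (simp add: algebra_simps flip: exp_add)
  finally have "ennreal c * (\<integral>\<^sup>+\<omega>. ennreal (norm (Y \<omega>) powr p) \<partial>M) \<le> ennreal c * ennreal (exp (rate * \<delta>max) * (V x0 + C))"
    using c by (simp add: ennreal_leI ennreal_mult')
  then have bound: "(\<integral>\<^sup>+\<omega>. ennreal (norm (Y \<omega>) powr p) \<partial>M) \<le> ennreal (exp (rate * \<delta>max) * (V x0 + C))"
    using c by (subst (asm) ennreal_mult_le_mult_iff) auto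
  show int: "integrable M (\<lambda>\<omega>. norm (Y \<omega>) powr p)"
    using bound Ym by (intro integrableI_nonneg) (auto simp: top_unique less_top intro: le_less_trans)
  have "ennreal (\<integral>\<omega>. norm (Y \<omega>) powr p \<partial>M) \<le> ennreal (exp (rate * \<delta>max) * (V x0 + C))"
    using bound int by (simp add: nn_integral_eq_integral)
  then show "(\<integral>\<omega>. norm (Y \<omega>) powr p \<partial>M) \<le> exp (rate * \<delta>max) * (V x0 + C)"
    using C0 by (subst (asm) ennreal_le_iff) auto
qed

lemma step_and_interp_moments:
  assumes C: "contraction_const C" and t: "0 \<le> t"
  shows "integrable M (\<lambda>\<omega>. norm (em_step f g \<delta> x0 (\<lambda>s. W s \<omega>) t) powr p)"
    "(\<integral>\<omega>. norm (em_step f g \<delta> x0 (\<lambda>s. W s \<omega>) t) powr p \<partial>M) \<le> exp (rate * \<delta>max) * (V x0 + C)"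
    "integrable M (\<lambda>\<omega>. norm (em_interp f g \<delta> x0 (\<lambda>s. W s \<omega>) t) powr p)"
    "(\<integral>\<omega>. norm (em_interp f g \<delta> x0 (\<lambda>s. W s \<omega>) t) powr p \<partial>M) \<le> exp (rate * \<delta>max) * (V x0 + C)"
proof -
  have dm: "0 \<le> \<delta>max" using step_pos[of 0] step_le[of 0] by simp
  have step: "AE \<omega> in M. \<exists>N. \<exists>s. t - \<delta>max \<le> s \<and>
      (\<forall>n\<ge>N. walk (freeze_rule t) n \<omega> = (s, em_step f g \<delta> x0 (\<lambda>s. W s \<omega>) t))"
    using no_explosion_before[OF t]
  proof eventually_elim
    case (elim \<omega>)
    then obtain N where N: "grid_time \<omega> N \<le> t" "t < grid_time \<omega> (Suc N)"
      using em_grid_interval_exists[where \<delta> = \<delta>, OF step_pos t] by blast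
    have "t - \<delta>max \<le> grid_time \<omega> N" using N step_le[of "grid_value \<omega> N"] by (simp add: em_time_Suc)
    then show ?case using freeze_walk_limit[OF N] em_at_grid_interval(2)[OF step_pos N]
      by (intro exI[of _ N] exI[of _ "grid_time \<omega> N"]) auto
  qed
  have interp: "AE \<omega> in M. \<exists>N. \<exists>s. t - \<delta>max \<le> s \<and>
      (\<forall>n\<ge>N. walk (stop_rule t) n \<omega> = (s, em_interp f g \<delta> x0 (\<lambda>s. W s \<omega>) t))"
    using no_explosion_before[OF t]
  proof eventually_elim
    case (elim \<omega>)
    then obtain N where N: "grid_time \<omega> N \<le> t" "t < grid_time \<omega> (Suc N)"
      using em_grid_interval_exists[where \<delta> = \<delta>, OF step_pos t] by blast
    then show ?case using stop_walk_limit[OF N] dm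
      by (intro exI[of _ "Suc N"] exI[of _ t]) auto
  qed
  show "integrable M (\<lambda>\<omega>. norm (em_step f g \<delta> x0 (\<lambda>s. W s \<omega>) t) powr p)"
    "(\<integral>\<omega>. norm (em_step f g \<delta> x0 (\<lambda>s. W s \<omega>) t) powr p \<partial>M) \<le> exp (rate * \<delta>max) * (V x0 + C)"
    by (rule walk_limit_moment[OF C admissible_rules(2) t step])+
  show "integrable M (\<lambda>\<omega>. norm (em_interp f g \<delta> x0 (\<lambda>s. W s \<omega>) t) powr p)"
    "(\<integral>\<omega>. norm (em_interp f g \<delta> x0 (\<lambda>s. W s \<omega>) t) powr p \<partial>M) \<le> exp (rate * \<delta>max) * (V x0 + C)"
    by (rule walk_limit_moment[OF C admissible_rules(1) t interp])+
qed

end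

theorem theorem5p4:
  fixes M :: "'a measure" and F :: "real \<Rightarrow> 'a measure"
    and W :: "real \<Rightarrow> 'a \<Rightarrow> real ^ 'm"
    and f :: "real ^ 'd \<Rightarrow> real ^ 'd" and g :: "real ^ 'd \<Rightarrow> real ^ 'm ^ 'd"
    and x0 :: "real ^ 'd" and \<delta> :: "real ^ 'd \<Rightarrow> real"
    and p K6 K7 \<delta>max \<gamma> :: real
  assumes "brownian_motion M F W"
    and "\<And>R. R > 0 \<Longrightarrow> \<exists>C>0. \<forall>x y. max (norm x) (norm y) \<le> R \<longrightarrow>
      norm (f x - f y) + norm (g x - g y) \<le> C * norm (x - y)"
    and "p \<ge> 2" and "K6 > 0" and "K7 \<ge> 0"
    and "\<And>x. x \<bullet> f x + (p - 1) / 2 * (norm (g x))\<^sup>2 \<le> - K6 * (norm x)\<^sup>2 + K7"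
    and "\<delta>max > 0"
    and "\<And>x. 0 < \<delta> x \<and> \<delta> x \<le> \<delta>max"
    and "continuous_on UNIV \<delta>"
    and "(\<delta> \<longlongrightarrow> 0) at_infinity"
    and "0 < \<gamma>" and "\<gamma> \<le> 1 / 3"
    and "\<And>x. norm (f x) * \<delta> x powr \<gamma> \<le> 1 + norm x"
    and "\<And>x. (norm (g x))\<^sup>2 * \<delta> x powr \<gamma> \<le> (1 + norm x)\<^sup>2"
  shows "(AE \<omega> in M. \<forall>t\<ge>0. \<exists>n. t < em_time f g \<delta> x0 (\<lambda>s. W s \<omega>) n) \<and>
    (\<exists>C>0.
      (\<forall>t\<ge>0. integrable M (\<lambda>\<omega>. norm (em_step f g \<delta> x0 (\<lambda>s. W s \<omega>) t) powr p) \<and>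
        (\<integral>\<omega>. norm (em_step f g \<delta> x0 (\<lambda>s. W s \<omega>) t) powr p \<partial>M) \<le> C) \<and>
      (\<forall>t\<ge>0. integrable M (\<lambda>\<omega>. norm (em_interp f g \<delta> x0 (\<lambda>s. W s \<omega>) t) powr p) \<and>
        (\<integral>\<omega>. norm (em_interp f g \<delta> x0 (\<lambda>s. W s \<omega>) t) powr p \<partial>M) \<le> C))"
proof -
  interpret brownian_motion M F W by (rule assms(1))
  interpret em_brownian M F W f g \<delta> p K6 K7 \<delta>max \<gamma> x0
    by unfold_locales (use assms in blast)+
  obtain C where C: "contraction_const C" using contraction_const_exists by blast
  have "1 \<le> V x0" unfolding V_def using p_ge by (intro ge_one_powr_ge_zero) auto
  then have "0 < exp (rate * \<delta>max) * (V x0 + C)" using C by (simp add: contraction_const_def)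
  then show ?thesis using no_explosion step_and_interp_moments[OF C] by blast
qed

end
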